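(* Let $p_i = 1/m$ and $n_i = n$ for all $i\in[m]$, and put $N = mn$. Suppose the smoothness, strong convexity, and bounded-gradient-variance assumptions (A1), (A2), (A3) hold, and consider the parameter space $\mathcal{P}(R)$, i.e. $\{\boldsymbol{w}_\star^{(i)}\}_{i=1}^m \in \mathcal{P}(R)$. Then the local models $\{\widetilde{\boldsymbol{w}}^{(i)}\}_{i=1}^m$ obtained by solving Problem (P) satisfy $$\mathbb{E}\big\|\widetilde{\boldsymbol{w}}^{(i)} - \boldsymbol{w}_\star^{(i)}\big\|^2 \le \min\Big\{ \frac{48\rho^2}{\mu^2}\frac{1}{N} + \Big(\frac{48L^2}{\mu^2}+3\Big)R^2 + \frac{1}{q_1(\lambda)},\;\; \frac{4\rho^2}{\mu^2}\frac1n + \Big[\Big(\frac{4\rho^2}{\mu^3}\frac1n + \frac{4}{\mu}R^2\Big)\lambda + \frac{8}{\mu^2}R^2\lambda^2\Big]\Big\},$$ where $q_1(\lambda)$, defined in the context, is a monotonically increasing function of $\lambda$ with $\lim_{\lambda\to\infty} q_1(\lambda)=\infty$.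
   Context: Setting. There are $m$ clients; client $i\in[m]=\{1,\dots,m\}$ has data $S_i=\{z_{ij}\}_{j\in[n_i]}$ with elements drawn i.i.d. from a distribution $\mathcal{D}_i$ (the $\mathcal D_i$ may differ between clients). $\ell(\boldsymbol{w},z)$ is a loss function of $\boldsymbol{w}\in\mathbb{R}^d$ ($d$ finite) and a data point $z$; $\nabla\ell$ is the gradient in $\boldsymbol{w}$. $L_i(\boldsymbol{w},S_i)=\frac1{n_i}\sum_{j=1}^{n_i}\ell(\boldsymbol{w},z_{ij})$. The ground truth model of client $i$ is $\boldsymbol{w}_\star^{(i)}\in\arg\min_{\boldsymbol{w}}\mathbb{E}_{z\sim\mathcal{D}_i}\ell(\boldsymbol{w},z)$. $\|\cdot\|$ is the Euclidean norm; $\mathbb{E}$ is over the joint distribution of all data. Problem (P): with nonnegative weights $p_i$, $\sum_i p_i=1$, and regularization parameter $\lambda$ (ranging between $0$ and $\infty$), $\big(\widetilde{\boldsymbol{w}}^{(g)},\{\widetilde{\boldsymbol{w}}^{(i)}\}_{i=1}^m\big)$ is the solution of $$\min_{\boldsymbol{w}^{(g)},\{\boldsymbol{w}^{(i)}\}_{i=1}^m}\ \sum_{i\in[m]}p_i\Big(L_i(\boldsymbol{w}^{(i)},S_i)+\frac{\lambda}{2}\|\boldsymbol{w}^{(g)}-\boldsymbol{w}^{(i)}\|^2\Big).$$ Parameter space: $\mathcal{P}(R)=\big\{\{\boldsymbol{w}_\star^{(i)}\}_{i=1}^m:\ \|\boldsymbol{w}_\star^{(i)}-\sum_{k=1}^m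 p_k\boldsymbol{w}_\star^{(k)}\|^2\le R^2\ \forall i\in[m]\big\}$. Assumptions. (A1) $\|\nabla\ell(x,z)-\nabla\ell(y,z)\|\le L\|x-y\|$ for all $x,y\in\mathbb{R}^d$ and all $z$. (A2) Each $L_i(\cdot,S_i)$ is $\mu$-strongly convex: $L_i(x,S_i)\ge L_i(y,S_i)+\langle\nabla L_i(y,S_i),x-y\rangle+\frac{\mu}{2}\|x-y\|^2$ for all $x,y\in\mathbb{R}^d$ and $i\in[m]$. (A3) There is a nonnegative constant $\rho$ with $\mathbb{E}_{z\sim\mathcal{D}_i}\|\nabla\ell(\boldsymbol{w}_\star^{(i)},z)\|^2\le\rho^2$ for all $i\in[m]$. Definition of $q_1$. With $g(\lambda)=\frac{4}{\mu}\Big(\frac{1}{\mu+\lambda}+\frac{L}{(\mu+\lambda)^2}\Big)$, $$[q_1(\lambda)]^{-1}=\frac{12}{(\mu+\lambda)^2}\Big[4L^2R^2+2\frac{\rho^2}{n}\Big]+\frac{48L^2}{(\mu+\lambda)^2}\Big[\frac{g(\lambda)}{1-4L^2g(\lambda)}\Big(4L^2R^2+2\frac{\rho^2}{n}\Big)+2\Big(\frac{8\rho^2}{\mu^2}\frac1N+\frac{8L^2}{\mu^2}R^2\Big)\Big]+\frac{3g(\lambda)}{1-4L^2g(\lambda)}\Big(4L^2R^2+2\frac{\rho^2}{n}\Big).$$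
   Formalization: The first bound in the min and the monotonicity of q_1 are asserted only for λ with 4L²g(λ)<1; the second bound holds for all λ≥0. As λ increases to the point where 4L²g(λ)=1, 1/q_1 tends to −∞ (unless R=ρ=0), so the literal bound fails there. *)

theory Defs
  imports "HOL-Probability.Probability"
begin

text \<open>Throughout, clients and samples are indexed from 1; a data array \<open>S\<close> has
  \<open>S i j\<close> as the \<open>j\<close>-th data point of client \<open>i\<close>.\<close>

definition gradient :: "('a::real_inner \<Rightarrow> real) \<Rightarrow> 'a \<Rightarrow> 'a" where
  "gradient f x = (THE D. GDERIV f x :> D)"

text \<open>Only meaningful for differentiable functions, for which \<open>gradient\<close> is well defined.\<close>

definition strongly_convex :: "real \<Rightarrow> ('a::real_inner \<Rightarrow> real) \<Rightarrow> bool" where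
  "strongly_convex \<mu> f \<longleftrightarrow>
     (\<forall>x y. f x \<ge> f y + gradient f y \<bullet> (x - y) + \<mu> / 2 * (norm (x - y))\<^sup>2)"

definition emp_loss :: "('w \<Rightarrow> 'z \<Rightarrow> real) \<Rightarrow> nat \<Rightarrow> (nat \<Rightarrow> 'z) \<Rightarrow> 'w \<Rightarrow> real" where
  "emp_loss \<l> n s w = 1 / real n * (\<Sum>j = 1..n. \<l> w (s j))"

definition pop_loss :: "('w \<Rightarrow> 'z \<Rightarrow> real) \<Rightarrow> 'z measure \<Rightarrow> 'w \<Rightarrow> real" where
  "pop_loss \<l> D w = (\<integral>z. \<l> w z \<partial>D)"

definition objective ::
  "('w::real_normed_vector \<Rightarrow> 'z \<Rightarrow> real) \<Rightarrow> nat \<Rightarrow> (nat \<Rightarrow> nat) \<Rightarrow> (nat \<Rightarrow> real) \<Rightarrow> real \<Rightarrow>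
   (nat \<Rightarrow> nat \<Rightarrow> 'z) \<Rightarrow> 'w \<times> (nat \<Rightarrow> 'w) \<Rightarrow> real" where
  "objective \<l> m n p lam S = (\<lambda>(wg, w).
     \<Sum>i = 1..m. p i * (emp_loss \<l> (n i) (S i) (w i) + lam / 2 * (norm (wg - w i))\<^sup>2))"

text \<open>The value of \<open>w i\<close> for \<open>i\<close> outside \<open>{1..m}\<close> does not affect the objective, so it is
  unconstrained in a solution.\<close>

definition is_solution ::
  "('w::real_normed_vector \<Rightarrow> 'z \<Rightarrow> real) \<Rightarrow> nat \<Rightarrow> (nat \<Rightarrow> nat) \<Rightarrow> (nat \<Rightarrow> real) \<Rightarrow> real \<Rightarrow>
   (nat \<Rightarrow> nat \<Rightarrow> 'z) \<Rightarrow> 'w \<Rightarrow> (nat \<Rightarrow> 'w) \<Rightarrow> bool" where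
  "is_solution \<l> m n p lam S wg w \<longleftrightarrow>
     is_arg_min (objective \<l> m n p lam S) (\<lambda>_. True) (wg, w)"

definition param_space ::
  "nat \<Rightarrow> (nat \<Rightarrow> real) \<Rightarrow> real \<Rightarrow> (nat \<Rightarrow> 'w::real_normed_vector) set" where
  "param_space m p R =
     {v. \<forall>i\<in>{1..m}. (norm (v i - (\<Sum>k = 1..m. p k *\<^sub>R v k)))\<^sup>2 \<le> R\<^sup>2}"

definition g_fun :: "real \<Rightarrow> real \<Rightarrow> real \<Rightarrow> real" where
  "g_fun \<mu> L lam = 4 / \<mu> * (1 / (\<mu> + lam) + L / (\<mu> + lam)\<^sup>2)"

text \<open>\<open>q1_recip\<close> is the expression for \<open>[q\<^sub>1(\<lambda>)]\<^sup>-\<^sup>1\<close>. It is meaningful as an error term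
  only when \<open>1 - 4 * L\<^sup>2 * g_fun \<mu> L lam\<close> is positive: at a zero it is undefined
  (division by zero yields 0 here), and as \<open>lam\<close> increases to that point it tends to minus
  infinity unless \<open>R = \<rho> = 0\<close>.\<close>

definition q1_recip ::
  "real \<Rightarrow> real \<Rightarrow> real \<Rightarrow> real \<Rightarrow> nat \<Rightarrow> nat \<Rightarrow> real \<Rightarrow> real" where
  "q1_recip \<mu> L R \<rho> n N lam =
     12 / (\<mu> + lam)\<^sup>2 * (4 * L\<^sup>2 * R\<^sup>2 + 2 * (\<rho>\<^sup>2 / real n))
   + 48 * L\<^sup>2 / (\<mu> + lam)\<^sup>2 *
       (g_fun \<mu> L lam / (1 - 4 * L\<^sup>2 * g_fun \<mu> L lam) * (4 * L\<^sup>2 * R\<^sup>2 + 2 * (\<rho>\<^sup>2 / real n))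
        + 2 * (8 * \<rho>\<^sup>2 / \<mu>\<^sup>2 * (1 / real N) + 8 * L\<^sup>2 / \<mu>\<^sup>2 * R\<^sup>2))
   + 3 * g_fun \<mu> L lam / (1 - 4 * L\<^sup>2 * g_fun \<mu> L lam) * (4 * L\<^sup>2 * R\<^sup>2 + 2 * (\<rho>\<^sup>2 / real n))"

text \<open>Extended reals are used because \<open>q1_recip\<close> vanishes identically when \<open>R = \<rho> = 0\<close>;
  the inverse of 0 is then infinity, as it should be.\<close>

definition q1 ::
  "real \<Rightarrow> real \<Rightarrow> real \<Rightarrow> real \<Rightarrow> nat \<Rightarrow> nat \<Rightarrow> real \<Rightarrow> ereal" where
  "q1 \<mu> L R \<rho> n N lam = inverse (ereal (q1_recip \<mu> L R \<rho> n N lam))"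

text \<open>The set of \<open>\<lambda>\<close> on which \<open>q\<^sub>1\<close> is a well-defined positive quantity; as \<open>g_fun\<close> decreases,
  it contains every larger \<open>\<lambda>\<close> along with each of its elements.\<close>

definition q1_domain :: "real \<Rightarrow> real \<Rightarrow> real set" where
  "q1_domain \<mu> L = {lam. 0 \<le> lam \<and> 4 * L\<^sup>2 * g_fun \<mu> L lam < 1}"

end

theory Submission
  imports Defs
begin

text \<open>
  The stationarity conditions \<open>\<nabla>L\<^sub>i(w\<^sub>i) = \<lambda>(v - w\<^sub>i)\<close>, with \<open>v\<close> the average of the local models,
  hold even for \<open>\<lambda> = 0\<close>. Write \<open>u\<^sub>i\<close> for the ground truth models, \<open>u\<close> for their average and
  \<open>G\<^sub>i = \<nabla>L\<^sub>i(u\<^sub>i)\<close>. Strong convexity gives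
  \<open>(\<mu> + \<lambda>) \<parallel>w\<^sub>i - u\<^sub>i\<parallel> \<le> \<lambda> \<parallel>v - u\<^sub>i\<parallel> + \<parallel>G\<^sub>i\<parallel>\<close>; averaging over the clients absorbs
  \<open>\<parallel>v - u\<parallel>\<close> and yields \<open>\<mu> \<parallel>w\<^sub>i - u\<^sub>i\<parallel> \<le> \<lambda>R + \<close> a convex combination of gradient norms, which is
  stronger than the second bound. For the first bound, \<open>\<parallel>v - w\<^sub>i\<parallel>\<close> is at most
  \<open>(\<parallel>G\<^sub>i\<parallel> + L(\<parallel>v - u\<parallel> + R)) / (\<mu> + \<lambda>)\<close>, whereas \<open>\<mu> \<parallel>v - u\<parallel>\<close> is at most
  \<open>L\<close> times the mean of these gaps plus \<open>\<parallel>mean of the G\<^sub>i\<parallel> + LR\<close>; on the domain of \<open>q\<^sub>1\<close> this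
  coupled system is a contraction. The \<open>G\<^sub>i\<close> are averages of independent gradients that are
  centred because the ground truth minimises the population loss, so
  \<open>E \<parallel>G\<^sub>i\<parallel>\<^sup>2 \<le> \<rho>\<^sup>2/n\<close> and \<open>E \<parallel>mean of the G\<^sub>i\<parallel>\<^sup>2 \<le> \<rho>\<^sup>2/N\<close>.
\<close>

subsection \<open>Gradients and convexity\<close>

lemma gradient_eq:
  fixes f :: "'a::real_inner \<Rightarrow> real"
  assumes "GDERIV f x :> D"
  shows "gradient f x = D"
  unfolding gradient_def
proof (rule the_equality[where P = "\<lambda>D. GDERIV f x :> D", OF assms])
  fix D' assume "GDERIV f x :> D'"
  then have "(\<lambda>h. h \<bullet> D') = (\<lambda>h. h \<bullet> D)"
    using assms unfolding gderiv_def by (rule has_derivative_unique)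
  then show "D' = D"
    by (metis vector_eq_ldot)
qed

text \<open>Riesz representation in coordinates: the values of the derivative on the basis are the
  coordinates of the representing vector.\<close>

lemma GDERIV_gradient:
  fixes f :: "'a::euclidean_space \<Rightarrow> real"
  assumes "f differentiable (at x)"
  shows "GDERIV f x :> gradient f x"
proof -
  obtain f' where f': "(f has_derivative f') (at x)"
    using assms unfolding differentiable_def by blast
  interpret bounded_linear f' by (rule has_derivative_bounded_linear[OF f'])
  have "f' h = h \<bullet> (\<Sum>b\<in>Basis. f' b *\<^sub>R b)" for h
  proof -
    have "f' h = f' (\<Sum>b\<in>Basis. (h \<bullet> b) *\<^sub>R b)" by (simp add: euclidean_representation)
    also have "\<dots> = h \<bullet> (\<Sum>b\<in>Basis. f' b *\<^sub>R b)"
      by (simp add: sum scale inner_sum_right mult.commute)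
    finally show ?thesis .
  qed
  then have "f' = (\<lambda>h. h \<bullet> (\<Sum>b\<in>Basis. f' b *\<^sub>R b))" by blast
  then have "GDERIV f x :> (\<Sum>b\<in>Basis. f' b *\<^sub>R b)"
    using f' unfolding gderiv_def by metis
  then show ?thesis by (simp add: gradient_eq)
qed

lemma GDERIV_emp_loss:
  fixes \<l> :: "'a::euclidean_space \<Rightarrow> 'z \<Rightarrow> real"
  assumes "\<And>j. j \<in> {1..n} \<Longrightarrow> (\<lambda>v. \<l> v (s j)) differentiable (at x)"
  shows "GDERIV (emp_loss \<l> n s) x :>
    (1 / real n) *\<^sub>R (\<Sum>j = 1..n. gradient (\<lambda>v. \<l> v (s j)) x)"
proof -
  have "((\<lambda>v. 1 / real n * (\<Sum>j = 1..n. \<l> v (s j))) has_derivative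
      (\<lambda>h. 1 / real n * (\<Sum>j = 1..n. h \<bullet> gradient (\<lambda>v. \<l> v (s j)) x))) (at x)"
    using GDERIV_gradient[OF assms] unfolding gderiv_def
    by (intro has_derivative_mult_right has_derivative_sum) auto
  then show ?thesis
    by (simp add: gderiv_def emp_loss_def[abs_def] inner_sum_right)
qed

text \<open>Adding the defining inequality to its copy with \<open>x\<close> and \<open>y\<close>
  exchanged cancels the function values.\<close>

lemma strongly_convex_gradient_monotone:
  assumes "strongly_convex \<mu> f"
  shows "\<mu> * (norm (x - y))\<^sup>2 \<le> (gradient f x - gradient f y) \<bullet> (x - y)"
proof -
  have "f x \<ge> f y + gradient f y \<bullet> (x - y) + \<mu> / 2 * (norm (x - y))\<^sup>2"
    and "f y \<ge> f x + gradient f x \<bullet> (y - x) + \<mu> / 2 * (norm (y - x))\<^sup>2"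
    using assms unfolding strongly_convex_def by blast+
  moreover have "gradient f x \<bullet> (y - x) = - (gradient f x \<bullet> (x - y))"
    by (simp add: inner_diff_right)
  ultimately show ?thesis
    by (simp add: inner_diff_left norm_minus_commute)
qed

text \<open>A descent lemma with constant \<open>L\<close> instead of \<open>L / 2\<close>: the mean
  value theorem replaces integration along the segment. The constant is immaterial, since the bound
  is used only to show that a first-order term vanishes.\<close>

lemma Lipschitz_gradient_upper_bound:
  fixes f :: "'a::euclidean_space \<Rightarrow> real"
  assumes diff: "\<And>x. f differentiable (at x)"
    and lip: "\<And>x y. norm (gradient f x - gradient f y) \<le> L * norm (x - y)"
  shows "f (x + v) - f x \<le> gradient f x \<bullet> v + L * (norm v)\<^sup>2"
proof -
  have der: "((\<lambda>t. f (x + t *\<^sub>R v)) has_derivative (\<lambda>h. (h *\<^sub>R v) \<bullet> gradient f (x + t *\<^sub>R v)))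
      (at t within {0..1})" for t :: real
  proof -
    have "((\<lambda>t. x + t *\<^sub>R v) has_derivative (\<lambda>h. h *\<^sub>R v)) (at t within {0..1})"
      by (auto intro!: derivative_eq_intros)
    then show ?thesis
      by (rule has_derivative_compose) (use GDERIV_gradient[OF diff] in \<open>simp add: gderiv_def\<close>)
  qed
  obtain t :: real where t: "t \<in> {0..1}"
    and eq: "f (x + 1 *\<^sub>R v) - f (x + 0 *\<^sub>R v) = ((1 - 0) *\<^sub>R v) \<bullet> gradient f (x + t *\<^sub>R v)"
    using mvt_very_simple[OF zero_le_one der] by blast
  have "norm (gradient f (x + t *\<^sub>R v) - gradient f x) \<le> L * norm (t *\<^sub>R v)"
    using lip[of "x + t *\<^sub>R v" x] by simp
  also have "\<dots> \<le> L * norm v"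
  proof (cases "v = 0")
    case False
    \<comment> \<open>The sign of \<open>L\<close> is not given; a nonzero \<open>v\<close> forces
      it through \<open>lip\<close>.\<close>
    have "0 \<le> L * norm (v - 0)" by (rule order_trans[OF norm_ge_zero lip])
    then have "t * (L * norm v) \<le> 1 * (L * norm v)"
      using t by (intro mult_right_mono) auto
    then show ?thesis using t by (simp add: mult_ac)
  qed simp
  finally have "norm (gradient f (x + t *\<^sub>R v) - gradient f x) * norm v \<le> L * norm v * norm v"
    by (rule mult_right_mono) simp
  moreover have "(gradient f (x + t *\<^sub>R v) - gradient f x) \<bullet> v
      \<le> norm (gradient f (x + t *\<^sub>R v) - gradient f x) * norm v"
    by (rule norm_cauchy_schwarz)
  ultimately show ?thesis
    using eq by (simp add: inner_diff_left inner_commute[of v] power2_eq_square)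
qed

subsection \<open>Random gradients\<close>

text \<open>Each coordinate of the gradient is the pointwise limit of difference quotients with
  steps \<open>1 / (k + 1)\<close>, and these are measurable.\<close>

lemma borel_measurable_gradient:
  fixes f :: "'a::euclidean_space \<Rightarrow> 'z \<Rightarrow> real"
  assumes diff: "\<And>s. s \<in> space M \<Longrightarrow> (\<lambda>v. f v s) differentiable (at x)"
    and [measurable]: "\<And>x. f x \<in> borel_measurable M"
  shows "(\<lambda>s. gradient (\<lambda>v. f v s) x) \<in> borel_measurable M"
proof (rule borel_measurable_euclidean_space[THEN iffD2], rule ballI)
  fix b :: 'a assume "b \<in> Basis"
  let ?u = "\<lambda>k s. (f (x + inverse (real (Suc k)) *\<^sub>R b) s - f x s) * real (Suc k)"
  show "(\<lambda>s. gradient (\<lambda>v. f v s) x \<bullet> b) \<in> borel_measurable M"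
  proof (rule borel_measurable_LIMSEQ_real)
    fix s assume s: "s \<in> space M"
    have "((\<lambda>t::real. f (x + t *\<^sub>R b) s) has_derivative
        (\<lambda>h. (h *\<^sub>R b) \<bullet> gradient (\<lambda>v. f v s) x)) (at 0)"
    proof -
      have "((\<lambda>t. x + t *\<^sub>R b) has_derivative (\<lambda>h. h *\<^sub>R b)) (at (0::real))"
        by (auto intro!: derivative_eq_intros)
      then show ?thesis
        by (rule has_derivative_compose[where g = "\<lambda>v. f v s"])
          (use GDERIV_gradient[OF diff[OF s]] in \<open>simp add: gderiv_def\<close>)
    qed
    also have "(\<lambda>h. (h *\<^sub>R b) \<bullet> gradient (\<lambda>v. f v s) x)
        = (*) (gradient (\<lambda>v. f v s) x \<bullet> b)"
      by (intro ext) (simp only: inner_scaleR_left inner_commute[of b] mult.commute)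
    finally have "DERIV (\<lambda>t. f (x + t *\<^sub>R b) s) 0 :> gradient (\<lambda>v. f v s) x \<bullet> b"
      by (simp only: has_field_derivative_def)
    then have lim: "((\<lambda>h. (f (x + h *\<^sub>R b) s - f x s) / h) \<longlongrightarrow> gradient (\<lambda>v. f v s) x \<bullet> b) (at 0)"
      by (simp add: DERIV_def)
    have "filterlim (\<lambda>k. inverse (real (Suc k))) (at 0) sequentially"
      unfolding filterlim_at
      by (intro conjI LIMSEQ_inverse_real_of_nat always_eventually) simp
    from filterlim_compose[OF lim this]
    show "(\<lambda>k. ?u k s) \<longlonglongrightarrow> gradient (\<lambda>v. f v s) x \<bullet> b"
      by (simp only: divide_inverse inverse_inverse_eq)
  qed measurable
qed

text \<open>This avoids differentiating under the integral: integrating the descent inequality at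
  the minimiser gives \<open>0 \<le> E \<bullet> v + L * (norm v)\<^sup>2\<close> for every
  \<open>v\<close>, and a short step \<open>v\<close> against \<open>E\<close> contradicts this
  unless \<open>E = 0\<close>.\<close>

lemma (in prob_space) integral_gradient_pop_loss_minimizer:
  fixes \<l> :: "'b::euclidean_space \<Rightarrow> 'a \<Rightarrow> real"
  assumes diff: "\<And>x s. s \<in> space M \<Longrightarrow> (\<lambda>v. \<l> v s) differentiable (at x)"
    and intg: "\<And>x. integrable M (\<l> x)"
    and lip: "\<And>x y s. s \<in> space M \<Longrightarrow>
       norm (gradient (\<lambda>v. \<l> v s) x - gradient (\<lambda>v. \<l> v s) y) \<le> L * norm (x - y)"
    and L: "0 \<le> L"
    and min: "is_arg_min (pop_loss \<l> M) (\<lambda>_. True) x"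
    and int_grad: "integrable M (\<lambda>s. gradient (\<lambda>v. \<l> v s) x)"
  shows "expectation (\<lambda>s. gradient (\<lambda>v. \<l> v s) x) = 0"
proof -
  define G where "G = (\<lambda>s. gradient (\<lambda>v. \<l> v s) x)"
  define E where "E = expectation G"
  have int_G: "integrable M G" using int_grad by (simp add: G_def)
  have ge: "0 \<le> E \<bullet> v + L * (norm v)\<^sup>2" for v
  proof -
    have "0 \<le> pop_loss \<l> M (x + v) - pop_loss \<l> M x"
      using min unfolding is_arg_min_def by (simp add: not_less)
    also have "\<dots> = expectation (\<lambda>s. \<l> (x + v) s - \<l> x s)"
      using intg by (simp add: pop_loss_def)
    also have "\<dots> \<le> expectation (\<lambda>s. G s \<bullet> v + L * (norm v)\<^sup>2)"
    proof (rule integral_mono)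
      fix s assume "s \<in> space M"
      then show "\<l> (x + v) s - \<l> x s \<le> G s \<bullet> v + L * (norm v)\<^sup>2"
        unfolding G_def by (intro Lipschitz_gradient_upper_bound diff lip)
    qed (use intg int_G in auto)
    also have "\<dots> = E \<bullet> v + L * (norm v)\<^sup>2"
      using int_G by (simp add: E_def prob_space)
    finally show ?thesis .
  qed
  \<comment> \<open>Any positive step with \<open>L * t < 1\<close> works; \<open>L + 1\<close>
    keeps the denominator positive when \<open>L = 0\<close>.\<close>
  define t where "t = 1 / (2 * (L + 1))"
  have t: "t > 0" "L * t < 1" using L by (auto simp: t_def field_simps)
  have "0 \<le> E \<bullet> ((- t) *\<^sub>R E) + L * (norm ((- t) *\<^sub>R E))\<^sup>2" by (rule ge)
  also have "\<dots> = - (t * (1 - L * t) * (norm E)\<^sup>2)"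
    by (simp add: power_mult_distrib dot_square_norm algebra_simps) (simp add: power2_eq_square)
  finally have "t * (1 - L * t) * (norm E)\<^sup>2 \<le> 0" by simp
  moreover have "t * (1 - L * t) > 0" using t by simp
  ultimately have "(norm E)\<^sup>2 \<le> 0" by (metis mult_le_cancel_left_pos mult_zero_right)
  then have "norm E = 0" by simp
  then show ?thesis by (simp add: E_def G_def)
qed

text \<open>Expanding the square leaves only the diagonal: inner products of distinct summands have
  mean zero by independence and centring.\<close>

lemma (in prob_space) expectation_norm_sum_indep_le:
  fixes X :: "'i \<Rightarrow> 'a \<Rightarrow> 'b::euclidean_space"
  assumes fin: "finite A"
    and indep: "indep_vars (\<lambda>_. borel) X A"
    and sq: "\<And>i. i \<in> A \<Longrightarrow> integrable M (\<lambda>\<omega>. (norm (X i \<omega>))\<^sup>2)"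
    and zero: "\<And>i. i \<in> A \<Longrightarrow> expectation (X i) = 0"
    and le: "\<And>i. i \<in> A \<Longrightarrow> expectation (\<lambda>\<omega>. (norm (X i \<omega>))\<^sup>2) \<le> c"
  shows "integrable M (\<lambda>\<omega>. (norm (\<Sum>i\<in>A. X i \<omega>))\<^sup>2)"
    and "expectation (\<lambda>\<omega>. (norm (\<Sum>i\<in>A. X i \<omega>))\<^sup>2) \<le> real (card A) * c"
proof -
  have meas: "X i \<in> borel_measurable M" if "i \<in> A" for i
    using indep that by (auto simp: indep_vars_def)
  have int_X: "integrable M (X i)" if "i \<in> A" for i
  proof -
    have "integrable M (\<lambda>\<omega>. norm (X i \<omega>))"
      by (rule square_integrable_imp_integrable) (use meas sq that in auto)
    then show ?thesis using meas[OF that] by (simp add: integrable_norm_iff)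
  qed
  have off: "integrable M (\<lambda>\<omega>. X i \<omega> \<bullet> X j \<omega>) \<and> expectation (\<lambda>\<omega>. X i \<omega> \<bullet> X j \<omega>) = 0"
    if ij: "i \<in> A" "j \<in> A" "i \<noteq> j" for i j
  proof -
    \<comment> \<open>Independence factors expectations of products of scalars, so the inner product
      is treated coordinate by coordinate.\<close>
    have comp: "integrable M (\<lambda>\<omega>. (X i \<omega> \<bullet> b) * (X j \<omega> \<bullet> b)) \<and>
        expectation (\<lambda>\<omega>. (X i \<omega> \<bullet> b) * (X j \<omega> \<bullet> b)) = 0" for b
    proof -
      have "indep_vars (\<lambda>_. borel) X {i, j}"
        using indep by (rule indep_vars_subset) (use ij in auto)
      then have ind: "indep_vars (\<lambda>_. borel) (\<lambda>k \<omega>. X k \<omega> \<bullet> b) {i, j}"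
        by (rule indep_vars_compose2) simp
      have int: "integrable M (\<lambda>\<omega>. X k \<omega> \<bullet> b)" if "k \<in> {i, j}" for k
        using that ij int_X by auto
      have "expectation (\<lambda>\<omega>. X i \<omega> \<bullet> b) = 0"
        using int_X[OF ij(1)] zero[OF ij(1)] by simp
      then show ?thesis
        using indep_vars_lebesgue_integral[OF _ ind int] indep_vars_integrable[OF _ ind int] ij
        by simp
    qed
    have "(\<lambda>\<omega>. X i \<omega> \<bullet> X j \<omega>) = (\<lambda>\<omega>. \<Sum>b\<in>Basis. (X i \<omega> \<bullet> b) * (X j \<omega> \<bullet> b))"
      by (intro ext euclidean_inner)
    then show ?thesis by (simp add: comp)
  qed
  have int_ij: "integrable M (\<lambda>\<omega>. X i \<omega> \<bullet> X j \<omega>)" if "i \<in> A" "j \<in> A" for i j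
    using off[of i j] sq[of i] that by (cases "i = j") (auto simp: power2_norm_eq_inner)
  have expand: "(norm (\<Sum>i\<in>A. X i \<omega>))\<^sup>2 = (\<Sum>i\<in>A. \<Sum>j\<in>A. X i \<omega> \<bullet> X j \<omega>)" for \<omega>
    by (subst sum.swap) (simp add: power2_norm_eq_inner inner_sum_left inner_sum_right)
  show "integrable M (\<lambda>\<omega>. (norm (\<Sum>i\<in>A. X i \<omega>))\<^sup>2)"
    unfolding expand by (intro Bochner_Integration.integrable_sum int_ij)
  have "expectation (\<lambda>\<omega>. (norm (\<Sum>i\<in>A. X i \<omega>))\<^sup>2)
      = (\<Sum>i\<in>A. \<Sum>j\<in>A. expectation (\<lambda>\<omega>. X i \<omega> \<bullet> X j \<omega>))"
    unfolding expand by (simp add: int_ij)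
  also have "\<dots> = (\<Sum>i\<in>A. \<Sum>j\<in>A. if i = j then expectation (\<lambda>\<omega>. X i \<omega> \<bullet> X i \<omega>) else 0)"
    by (intro sum.cong refl) (use off in auto)
  also have "\<dots> = (\<Sum>i\<in>A. expectation (\<lambda>\<omega>. (norm (X i \<omega>))\<^sup>2))"
    using fin by (simp add: power2_norm_eq_inner)
  also have "\<dots> \<le> real (card A) * c"
    using sum_mono[OF le, of A "\<lambda>i. i"] by simp
  finally show "expectation (\<lambda>\<omega>. (norm (\<Sum>i\<in>A. X i \<omega>))\<^sup>2) \<le> real (card A) * c" .
qed

subsection \<open>Deterministic error bounds\<close>

lemma sum_squared_le_three: "((a::real) + b + c)\<^sup>2 \<le> 3 * (a\<^sup>2 + b\<^sup>2 + c\<^sup>2)"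
proof -
  have "0 \<le> (a - b)\<^sup>2 + (b - c)\<^sup>2 + (a - c)\<^sup>2" by simp
  then show ?thesis by (simp add: power2_eq_square algebra_simps)
qed

lemma sum_squared_le_four: "((a::real) + b + c + d)\<^sup>2 \<le> 4 * (a\<^sup>2 + b\<^sup>2 + c\<^sup>2 + d\<^sup>2)"
proof -
  have "0 \<le> (a - b)\<^sup>2 + (a - c)\<^sup>2 + (a - d)\<^sup>2 + (b - c)\<^sup>2 + (b - d)\<^sup>2 + (c - d)\<^sup>2" by simp
  then show ?thesis by (simp add: power2_eq_square algebra_simps)
qed

lemma square_convex_combination_le:
  assumes "0 \<le> t" "t \<le> 1"
  shows "(t * a + (1 - t) * b :: real)\<^sup>2 \<le> t * a\<^sup>2 + (1 - t) * b\<^sup>2"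
proof -
  have "t * a\<^sup>2 + (1 - t) * b\<^sup>2 - (t * a + (1 - t) * b)\<^sup>2 = t * (1 - t) * (a - b)\<^sup>2"
    by (simp add: power2_eq_square algebra_simps)
  also have "\<dots> \<ge> 0" using assms by simp
  finally show ?thesis by simp
qed

lemma mean_squared_le:
  fixes f :: "'i \<Rightarrow> real"
  assumes "card I \<noteq> 0"
  shows "((\<Sum>i\<in>I. f i) / real (card I))\<^sup>2 \<le> (\<Sum>i\<in>I. (f i)\<^sup>2) / real (card I)"
proof -
  have "(\<Sum>i\<in>I. f i)\<^sup>2 \<le> real (card I) * (\<Sum>i\<in>I. (f i)\<^sup>2)"
    using sum_squared_le_sum_of_squares[of f I] by (simp add: mult.commute)
  then show ?thesis using assms by (simp add: field_simps power2_eq_square)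
qed

text \<open>\<open>w\<close> and \<open>v\<close> play the roles of the local models and the global model; \<open>F i\<close> is the gradient
  of the \<open>i\<close>-th empirical loss, so that \<open>stat\<close> and \<open>v\<close> are the first-order conditions of
  Problem (P).\<close>

locale regularized_stationary =
  fixes F :: "nat \<Rightarrow> 'a::real_inner \<Rightarrow> 'a" and m :: nat and \<mu> L lam R :: real
    and u w :: "nat \<Rightarrow> 'a" and ubar v :: 'a
  assumes m: "1 \<le> m" and mu: "0 < \<mu>" and L: "0 \<le> L" and lam: "0 \<le> lam"
    and mono: "\<And>i x y. i \<in> {1..m} \<Longrightarrow> \<mu> * (norm (x - y))\<^sup>2 \<le> (F i x - F i y) \<bullet> (x - y)"
    and lip: "\<And>i x y. i \<in> {1..m} \<Longrightarrow> norm (F i x - F i y) \<le> L * norm (x - y)"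
    and stat: "\<And>i. i \<in> {1..m} \<Longrightarrow> F i (w i) = lam *\<^sub>R (v - w i)"
    and v: "v = (1 / real m) *\<^sub>R (\<Sum>i = 1..m. w i)"
    and ubar: "ubar = (1 / real m) *\<^sub>R (\<Sum>i = 1..m. u i)"
    and R: "\<And>i. i \<in> {1..m} \<Longrightarrow> norm (u i - ubar) \<le> R"
begin

lemma sum_w: "(\<Sum>i = 1..m. w i) = real m *\<^sub>R v"
  and sum_u: "(\<Sum>i = 1..m. u i) = real m *\<^sub>R ubar"
  using m by (simp_all add: v ubar)

text \<open>Test strong monotonicity between \<open>w i\<close> and \<open>u i\<close>. Splitting
  \<open>v - w i\<close> as \<open>(v - u i) - (w i - u i)\<close> in the stationarity condition
  contributes the extra \<open>lam\<close> on the left; then one factor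
  \<open>norm (w i - u i)\<close> cancels.\<close>

lemma norm_error_le:
  assumes i: "i \<in> {1..m}"
  shows "(\<mu> + lam) * norm (w i - u i) \<le> lam * norm (v - u i) + norm (F i (u i))"
proof (cases "w i = u i")
  case False
  let ?e = "w i - u i"
  have "\<mu> * (norm ?e)\<^sup>2 \<le> (lam *\<^sub>R (v - w i) - F i (u i)) \<bullet> ?e"
    using mono[OF i, of "w i" "u i"] stat[OF i] by simp
  also have "lam *\<^sub>R (v - w i) - F i (u i) = lam *\<^sub>R (v - u i) - F i (u i) - lam *\<^sub>R ?e"
    by (simp add: algebra_simps)
  also have "\<dots> \<bullet> ?e = (lam *\<^sub>R (v - u i) - F i (u i)) \<bullet> ?e - lam * (norm ?e)\<^sup>2"
    by (simp add: inner_diff_left[of _ "lam *\<^sub>R ?e"] dot_square_norm)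
  also have "(lam *\<^sub>R (v - u i) - F i (u i)) \<bullet> ?e \<le> norm (lam *\<^sub>R (v - u i) - F i (u i)) * norm ?e"
    by (rule norm_cauchy_schwarz)
  also have "\<dots> \<le> (lam * norm (v - u i) + norm (F i (u i))) * norm ?e"
    using norm_triangle_ineq4[of "lam *\<^sub>R (v - u i)" "F i (u i)"] lam
    by (intro mult_right_mono) auto
  finally have "((\<mu> + lam) * norm ?e) * norm ?e \<le> (lam * norm (v - u i) + norm (F i (u i))) * norm ?e"
    by (simp add: power2_eq_square algebra_simps)
  then show ?thesis using False by simp
qed (use lam in simp)

lemma norm_consensus_error_le: "real m * norm (v - ubar) \<le> (\<Sum>i = 1..m. norm (w i - u i))"
proof -
  have "real m * norm (v - ubar) = norm (\<Sum>i = 1..m. w i - u i)"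
    by (simp add: sum_subtractf sum_w[simplified] sum_u[simplified] flip: scaleR_diff_right)
  also have "\<dots> \<le> (\<Sum>i = 1..m. norm (w i - u i))" by (rule norm_sum)
  finally show ?thesis .
qed

lemma norm_v_minus_u_le:
  assumes i: "i \<in> {1..m}"
  shows "norm (v - u i) \<le> norm (v - ubar) + R"
  using norm_triangle_ineq4[of "v - ubar" "u i - ubar"] R[OF i] by simp

text \<open>Summing \<open>norm_error_le\<close> over the clients bounds the total error in terms of
  the consensus error \<open>x\<close>, which is itself at most the mean error. Hence
  \<open>lam * x\<close> is absorbed on the left and leaves the factor \<open>\<mu>\<close>. Putting
  the resulting bound on \<open>x\<close> back into the estimate for client \<open>i\<close>
  produces the weights \<open>lam / (\<mu> + lam)\<close> and
  \<open>\<mu> / (\<mu> + lam)\<close>.\<close>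

lemma local_error_le:
  assumes i: "i \<in> {1..m}"
  shows "\<mu> * norm (w i - u i) \<le> lam * R
    + (lam / (\<mu> + lam) * ((\<Sum>k = 1..m. norm (F k (u k))) / real m)
       + (1 - lam / (\<mu> + lam)) * norm (F i (u i)))"
proof -
  define S \<Gamma> x where "S = (\<Sum>i = 1..m. norm (w i - u i))"
    and "\<Gamma> = (\<Sum>k = 1..m. norm (F k (u k)))" and "x = norm (v - ubar)"
  have e: "(\<mu> + lam) * norm (w k - u k) \<le> lam * (x + R) + norm (F k (u k))"
    if "k \<in> {1..m}" for k
    using norm_error_le[OF that] mult_left_mono[OF norm_v_minus_u_le[OF that] lam]
    by (simp add: x_def)
  have "(\<Sum>k = 1..m. (\<mu> + lam) * norm (w k - u k))
      \<le> (\<Sum>k = 1..m. lam * (x + R) + norm (F k (u k)))"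
    by (intro sum_mono e)
  then have "(\<mu> + lam) * S \<le> lam * (real m * x) + lam * (real m * R) + \<Gamma>"
    by (simp add: S_def \<Gamma>_def sum.distrib algebra_simps flip: sum_distrib_left)
  moreover have xS: "real m * x \<le> S"
    using norm_consensus_error_le by (simp add: x_def S_def)
  \<comment> \<open>Here the \<open>lam\<close> part of \<open>(\<mu> + lam) * S\<close> absorbs the
    consensus term.\<close>
  ultimately have "\<mu> * S \<le> lam * (real m * R) + \<Gamma>"
    using mult_left_mono[OF xS lam] by (simp add: algebra_simps)
  then have "\<mu> * (real m * x) \<le> lam * (real m * R) + \<Gamma>"
    using mult_left_mono[OF xS less_imp_le[OF mu]] by linarith
  then have "\<mu> * x \<le> lam * R + \<Gamma> / real m"
    using m by (simp add: field_simps)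
  then have "lam * (\<mu> * x) \<le> lam * (lam * R + \<Gamma> / real m)"
    using lam by (rule mult_left_mono)
  moreover have "\<mu> * ((\<mu> + lam) * norm (w i - u i)) \<le> \<mu> * (lam * (x + R) + norm (F i (u i)))"
    using e[OF i] mu by simp
  ultimately have "(\<mu> + lam) * (\<mu> * norm (w i - u i))
      \<le> (\<mu> + lam) * (lam * R) + (lam * (\<Gamma> / real m) + \<mu> * norm (F i (u i)))"
    by (simp add: algebra_simps)
  also have "\<dots> = (\<mu> + lam) * (lam * R + (lam / (\<mu> + lam) * (\<Gamma> / real m)
      + (1 - lam / (\<mu> + lam)) * norm (F i (u i))))"
  proof -
    have "(\<mu> + lam) * (lam / (\<mu> + lam)) = lam" using mu lam by simp
    moreover from this have "(\<mu> + lam) * (1 - lam / (\<mu> + lam)) = \<mu>"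
      by (simp add: right_diff_distrib)
    ultimately show ?thesis by (simp only: distrib_left flip: mult.assoc)
  qed
  finally show ?thesis using mu lam by (simp add: \<Gamma>_def)
qed

text \<open>Convexity of the square keeps the weights intact. Both weighted quantities will have the
  same bound in expectation, so the weights then disappear.\<close>

lemma local_error_square_le:
  assumes i: "i \<in> {1..m}"
  shows "\<mu>\<^sup>2 * (norm (w i - u i))\<^sup>2 \<le> 2 * (lam\<^sup>2 * R\<^sup>2)
    + 2 * (lam / (\<mu> + lam) * ((\<Sum>k = 1..m. (norm (F k (u k)))\<^sup>2) / real m)
       + (1 - lam / (\<mu> + lam)) * (norm (F i (u i)))\<^sup>2)"
proof -
  define t where "t = lam / (\<mu> + lam)"
  define \<Gamma> where "\<Gamma> = (\<Sum>k = 1..m. norm (F k (u k))) / real m"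
  have t: "0 \<le> t" "t \<le> 1" using mu lam by (auto simp: t_def)
  let ?c = "t * \<Gamma> + (1 - t) * norm (F i (u i))"
  have "\<mu> * norm (w i - u i) \<le> lam * R + ?c"
    using local_error_le[OF i] by (simp add: t_def \<Gamma>_def)
  then have "(\<mu> * norm (w i - u i))\<^sup>2 \<le> (lam * R + ?c)\<^sup>2"
    using mu by (intro power_mono) auto
  also have "\<dots> \<le> 2 * (lam * R)\<^sup>2 + 2 * ?c\<^sup>2"
    using sum_squares_bound[of "lam * R" ?c] unfolding power2_sum[of "lam * R"] by linarith
  finally have "\<mu>\<^sup>2 * (norm (w i - u i))\<^sup>2 \<le> 2 * (lam\<^sup>2 * R\<^sup>2) + 2 * ?c\<^sup>2"
    by (simp add: power_mult_distrib)
  moreover have "?c\<^sup>2 \<le> t * \<Gamma>\<^sup>2 + (1 - t) * (norm (F i (u i)))\<^sup>2"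
    using t by (rule square_convex_combination_le)
  moreover have "\<Gamma>\<^sup>2 \<le> (\<Sum>k = 1..m. (norm (F k (u k)))\<^sup>2) / real m"
    using mean_squared_le[of "{1..m}" "\<lambda>k. norm (F k (u k))"] m by (simp add: \<Gamma>_def)
  from mult_left_mono[OF this t(1)]
  have "t * \<Gamma>\<^sup>2 \<le> t * ((\<Sum>k = 1..m. (norm (F k (u k)))\<^sup>2) / real m)" .
  ultimately show ?thesis
    unfolding t_def[symmetric] by (meson add_left_mono add_right_mono mult_left_mono order_trans zero_le_numeral)
qed

text \<open>Strong monotonicity between \<open>v\<close> and \<open>w i\<close>: stationarity makes
  \<open>F i (w i)\<close> parallel to \<open>v - w i\<close>, which adds \<open>lam\<close> to the
  modulus and leaves only \<open>F i v\<close> to be compared with \<open>F i (u i)\<close>.\<close>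

lemma norm_local_gap_le:
  assumes i: "i \<in> {1..m}"
  shows "(\<mu> + lam) * norm (v - w i) \<le> norm (F i (u i)) + L * (norm (v - ubar) + R)"
proof -
  let ?d = "v - w i"
  have "\<mu> * (norm ?d)\<^sup>2 \<le> F i v \<bullet> ?d - lam * (norm ?d)\<^sup>2"
    using mono[OF i, of v "w i"] stat[OF i] by (simp add: inner_diff_left[of "F i v"] dot_square_norm)
  moreover have "F i v \<bullet> ?d \<le> norm (F i v) * norm ?d" by (rule norm_cauchy_schwarz)
  ultimately have "((\<mu> + lam) * norm ?d) * norm ?d \<le> norm (F i v) * norm ?d"
    by (simp add: power2_eq_square algebra_simps)
  then have "(\<mu> + lam) * norm ?d \<le> norm (F i v)"
    by (cases "?d = 0") auto
  also have "\<dots> \<le> norm (F i (u i)) + norm (F i v - F i (u i))"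
    using norm_triangle_sub by blast
  also have "norm (F i v - F i (u i)) \<le> L * norm (v - u i)" by (rule lip[OF i])
  also have "\<dots> \<le> L * (norm (v - ubar) + R)"
    using norm_v_minus_u_le[OF i] L by (rule mult_left_mono)
  finally show ?thesis by simp
qed

text \<open>The \<open>F i (w i)\<close> sum to zero because \<open>v\<close> is the mean of the
  \<open>w i\<close>. Monotonicity of the summed gradients between \<open>v\<close> and
  \<open>ubar\<close> then leaves Lipschitz differences and the norm of the sum of the
  \<open>F i (u i)\<close>. Keeping this norm outside the sum is what later gives the rate in
  \<open>N\<close> instead of \<open>n\<close>.\<close>

lemma norm_consensus_error_le_gaps:
  "\<mu> * (real m * norm (v - ubar))
    \<le> L * (\<Sum>i = 1..m. norm (v - w i)) + norm (\<Sum>i = 1..m. F i (u i)) + real m * (L * R)"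
proof (cases "v = ubar")
  case True
  have "0 \<le> R" by (rule order_trans[OF norm_ge_zero R[of 1]]) (use m in simp)
  then show ?thesis using True L by (simp add: sum_nonneg)
next
  case False
  let ?x = "v - ubar"
  have "(\<Sum>i = 1..m. F i (w i)) = 0"
  proof -
    have "(\<Sum>i = 1..m. F i (w i)) = (\<Sum>i = 1..m. lam *\<^sub>R (v - w i))"
      by (intro sum.cong refl stat)
    also have "\<dots> = lam *\<^sub>R (real m *\<^sub>R v - (\<Sum>i = 1..m. w i))"
      by (simp add: sum_subtractf sum_constant_scaleR flip: scaleR_sum_right)
    finally show ?thesis by (simp add: sum_w[simplified])
  qed
  then have split: "(\<Sum>i = 1..m. F i v - F i ubar) = (\<Sum>i = 1..m. F i v - F i (w i))
      - (\<Sum>i = 1..m. F i (u i)) - (\<Sum>i = 1..m. F i ubar - F i (u i))"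
    by (simp add: sum_subtractf)
  have "norm (\<Sum>i = 1..m. F i v - F i (w i)) \<le> (\<Sum>i = 1..m. L * norm (v - w i))"
    by (intro sum_norm_le lip)
  moreover have "norm (\<Sum>i = 1..m. F i ubar - F i (u i)) \<le> (\<Sum>i = 1..m. L * R)"
  proof (intro sum_norm_le)
    fix i assume i: "i \<in> {1..m}"
    show "norm (F i ubar - F i (u i)) \<le> L * R"
      using lip[OF i, of ubar "u i"] mult_left_mono[OF R[OF i] L] by (simp add: norm_minus_commute)
  qed
  ultimately have le: "norm (\<Sum>i = 1..m. F i v - F i ubar)
      \<le> L * (\<Sum>i = 1..m. norm (v - w i)) + norm (\<Sum>i = 1..m. F i (u i)) + real m * (L * R)"
    unfolding split
    using norm_triangle_ineq4[of "(\<Sum>i = 1..m. F i v - F i (w i)) - (\<Sum>i = 1..m. F i (u i))"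
        "\<Sum>i = 1..m. F i ubar - F i (u i)"]
      norm_triangle_ineq4[of "\<Sum>i = 1..m. F i v - F i (w i)" "\<Sum>i = 1..m. F i (u i)"]
    by (simp flip: sum_distrib_left)
  have "(\<Sum>i = 1..m. \<mu> * (norm ?x)\<^sup>2) \<le> (\<Sum>i = 1..m. (F i v - F i ubar) \<bullet> ?x)"
    by (intro sum_mono mono)
  also have "\<dots> = (\<Sum>i = 1..m. F i v - F i ubar) \<bullet> ?x" by (simp add: inner_sum_left)
  also have "\<dots> \<le> norm (\<Sum>i = 1..m. F i v - F i ubar) * norm ?x" by (rule norm_cauchy_schwarz)
  finally have "(\<mu> * (real m * norm ?x)) * norm ?x
      \<le> norm (\<Sum>i = 1..m. F i v - F i ubar) * norm ?x"
    by (simp add: power2_eq_square algebra_simps)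
  then have "\<mu> * (real m * norm ?x) \<le> norm (\<Sum>i = 1..m. F i v - F i ubar)"
    using False by simp
  with le show ?thesis by linarith
qed

text \<open>Inserting \<open>norm_local_gap_le\<close> into
  \<open>norm_consensus_error_le_gaps\<close> bounds the consensus error by \<open>a * L\<close>
  times itself plus data terms; the hypothesis makes this a contraction and leaves
  \<open>15 / 16\<close> of it on the left.\<close>

lemma consensus_error_square_le:
  fixes a :: real
  defines "a \<equiv> L / (\<mu> * (\<mu> + lam))"
  assumes a: "a * L \<le> 1 / 16"
  shows "(norm (v - ubar))\<^sup>2 \<le> 5 * (a\<^sup>2 * ((\<Sum>k = 1..m. (norm (F k (u k)))\<^sup>2) / real m)
    + a\<^sup>2 * (L\<^sup>2 * R\<^sup>2) + (norm (\<Sum>i = 1..m. F i (u i)) / real m)\<^sup>2 / \<mu>\<^sup>2 + L\<^sup>2 * R\<^sup>2 / \<mu>\<^sup>2)"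
proof -
  define x \<Gamma> g where "x = norm (v - ubar)"
    and "\<Gamma> = (\<Sum>k = 1..m. norm (F k (u k))) / real m"
    and "g = norm (\<Sum>i = 1..m. F i (u i)) / real m"
  have "0 \<le> x" by (simp add: x_def)
  have pos: "0 < \<mu> + lam" "0 < real m" using mu lam m by auto
  have "(\<Sum>i = 1..m. (\<mu> + lam) * norm (v - w i))
      \<le> (\<Sum>i = 1..m. norm (F i (u i)) + L * (x + R))"
    unfolding x_def by (intro sum_mono norm_local_gap_le)
  then have gaps: "(\<mu> + lam) * (\<Sum>i = 1..m. norm (v - w i)) \<le> real m * (\<Gamma> + L * (x + R))"
    using pos by (simp add: \<Gamma>_def sum.distrib algebra_simps flip: sum_distrib_left)
  then have "(\<Sum>i = 1..m. norm (v - w i)) \<le> real m * (\<Gamma> + L * (x + R)) / (\<mu> + lam)"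
    using pos by (simp add: pos_le_divide_eq mult.commute)
  then have "L * (\<Sum>i = 1..m. norm (v - w i)) \<le> L * (real m * (\<Gamma> + L * (x + R)) / (\<mu> + lam))"
    using L by (rule mult_left_mono)
  with norm_consensus_error_le_gaps
  have "\<mu> * (real m * x) \<le> L * (real m * (\<Gamma> + L * (x + R)) / (\<mu> + lam)) + real m * g + real m * (L * R)"
    using pos by (simp add: x_def g_def)
  also have "\<dots> = \<mu> * real m * (a * (\<Gamma> + L * (x + R)) + (g + L * R) / \<mu>)"
  proof -
    have "\<mu> * a = L / (\<mu> + lam)" using mu by (simp add: a_def)
    moreover have "\<mu> * real m * (a * (\<Gamma> + L * (x + R)) + (g + L * R) / \<mu>)
        = real m * ((\<mu> * a) * (\<Gamma> + L * (x + R)) + (g + L * R))"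
      using mu by (simp add: field_simps)
    ultimately show ?thesis by (simp add: algebra_simps add_divide_distrib)
  qed
  finally have "x \<le> a * (\<Gamma> + L * (x + R)) + (g + L * R) / \<mu>"
    using mu pos by (simp flip: mult.assoc)
  then have "x \<le> (a * L) * x + (a * \<Gamma> + a * (L * R) + g / \<mu> + L * R / \<mu>)"
    by (simp add: algebra_simps add_divide_distrib)
  with mult_right_mono[OF a \<open>0 \<le> x\<close>]
  have "15 / 16 * x \<le> a * \<Gamma> + a * (L * R) + g / \<mu> + L * R / \<mu>" (is "_ \<le> ?s") by linarith
  define q where "q = (a * \<Gamma>)\<^sup>2 + (a * (L * R))\<^sup>2 + (g / \<mu>)\<^sup>2 + (L * R / \<mu>)\<^sup>2"
  from \<open>15 / 16 * x \<le> ?s\<close> have "(15 / 16 * x)\<^sup>2 \<le> ?s\<^sup>2" using \<open>0 \<le> x\<close> by (intro power_mono) auto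
  also have "\<dots> \<le> 4 * ((a * \<Gamma>)\<^sup>2 + (a * (L * R))\<^sup>2 + (g / \<mu>)\<^sup>2 + (L * R / \<mu>)\<^sup>2)"
    by (rule sum_squared_le_four)
  finally have "(15 / 16 * x)\<^sup>2 \<le> 4 * q" by (simp only: q_def)
  then have "225 / 256 * x\<^sup>2 \<le> 4 * q" by (simp add: power_mult_distrib power_divide)
  moreover have "0 \<le> q" by (simp add: q_def)
  \<comment> \<open>The exact factor is \<open>4 * 256 / 225\<close>, which is below 5.\<close>
  ultimately have "x\<^sup>2 \<le> 5 * q" by simp
  also have "q = a\<^sup>2 * \<Gamma>\<^sup>2 + a\<^sup>2 * (L\<^sup>2 * R\<^sup>2) + g\<^sup>2 / \<mu>\<^sup>2 + L\<^sup>2 * R\<^sup>2 / \<mu>\<^sup>2"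
    by (simp add: q_def power_mult_distrib power_divide)
  finally have "x\<^sup>2 \<le> 5 * (a\<^sup>2 * \<Gamma>\<^sup>2 + a\<^sup>2 * (L\<^sup>2 * R\<^sup>2) + g\<^sup>2 / \<mu>\<^sup>2 + L\<^sup>2 * R\<^sup>2 / \<mu>\<^sup>2)" .
  moreover have "\<Gamma>\<^sup>2 \<le> (\<Sum>k = 1..m. (norm (F k (u k)))\<^sup>2) / real m"
    using mean_squared_le[of "{1..m}" "\<lambda>k. norm (F k (u k))"] m by (simp add: \<Gamma>_def)
  from mult_left_mono[OF this zero_le_power2[of a]]
  have "a\<^sup>2 * \<Gamma>\<^sup>2 \<le> a\<^sup>2 * ((\<Sum>k = 1..m. (norm (F k (u k)))\<^sup>2) / real m)" .
  ultimately show ?thesis 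
    unfolding x_def g_def by (meson add_right_mono mult_left_mono order_trans zero_le_numeral)
qed

text \<open>The path from \<open>w i\<close> to \<open>u i\<close> through \<open>v\<close> and
  \<open>ubar\<close> has three legs, which costs a factor 3; the gap \<open>norm (v - w i)\<close>
  has a three-term bound of its own, whence the 9.\<close>

lemma local_error_square_le_consensus:
  assumes i: "i \<in> {1..m}"
  shows "(norm (w i - u i))\<^sup>2 \<le> 3 * R\<^sup>2 + 3 * (norm (v - ubar))\<^sup>2
    + 9 / (\<mu> + lam)\<^sup>2 * ((norm (F i (u i)))\<^sup>2 + L\<^sup>2 * R\<^sup>2 + L\<^sup>2 * (norm (v - ubar))\<^sup>2)"
proof -
  define x d where "x = norm (v - ubar)" and "d = norm (v - w i)"
  have pos: "0 < \<mu> + lam" using mu lam by simp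
  have "((\<mu> + lam) * d)\<^sup>2 \<le> (norm (F i (u i)) + L * R + L * x)\<^sup>2"
    using norm_local_gap_le[OF i] pos
    by (intro power_mono) (auto simp: d_def x_def distrib_left)
  also have "\<dots> \<le> 3 * ((norm (F i (u i)))\<^sup>2 + (L * R)\<^sup>2 + (L * x)\<^sup>2)"
    by (rule sum_squared_le_three)
  finally have d: "d\<^sup>2 \<le> 3 / (\<mu> + lam)\<^sup>2 * ((norm (F i (u i)))\<^sup>2 + L\<^sup>2 * R\<^sup>2 + L\<^sup>2 * x\<^sup>2)"
    using pos by (simp add: power_mult_distrib pos_le_divide_eq mult_ac)
  have "norm (w i - u i) \<le> d + x + R"
    using norm_v_minus_u_le[OF i] norm_triangle_ineq4[of "v - u i" "v - w i"]
    by (simp add: d_def x_def)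
  then have "(norm (w i - u i))\<^sup>2 \<le> (d + x + R)\<^sup>2" by (intro power_mono) auto
  also have "\<dots> \<le> 3 * (d\<^sup>2 + x\<^sup>2 + R\<^sup>2)" by (rule sum_squared_le_three)
  finally have "(norm (w i - u i))\<^sup>2 \<le> 3 * R\<^sup>2 + 3 * x\<^sup>2 + 3 * d\<^sup>2" by simp
  also have "3 * d\<^sup>2 \<le> 9 / (\<mu> + lam)\<^sup>2 * ((norm (F i (u i)))\<^sup>2 + L\<^sup>2 * R\<^sup>2 + L\<^sup>2 * x\<^sup>2)"
    using mult_left_mono[OF d, of 3] by simp
  finally show ?thesis by (simp add: x_def)
qed

end

text \<open>Vary one local model at a time, then the global model alone. The factor
  \<open>lam\<close> stays in the last conclusion because for \<open>lam = 0\<close> the global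
  model is arbitrary.\<close>

lemma solution_stationary:
  fixes \<l> :: "'a::euclidean_space \<Rightarrow> 'z \<Rightarrow> real"
  assumes sol: "is_solution \<l> m n p lam S wg w"
    and diff: "\<And>i x. i \<in> {1..m} \<Longrightarrow> emp_loss \<l> (n i) (S i) differentiable (at x)"
    and p: "\<And>i. i \<in> {1..m} \<Longrightarrow> 0 < p i"
  shows "i \<in> {1..m} \<Longrightarrow> gradient (emp_loss \<l> (n i) (S i)) (w i) = lam *\<^sub>R (wg - w i)"
    and "lam *\<^sub>R (\<Sum>i = 1..m. p i *\<^sub>R (wg - w i)) = 0"
proof -
  have opt: "objective \<l> m n p lam S (wg, w) \<le> objective \<l> m n p lam S y" for y
    using sol unfolding is_solution_def is_arg_min_def by (metis not_le)
  show "gradient (emp_loss \<l> (n i) (S i)) (w i) = lam *\<^sub>R (wg - w i)" if i: "i \<in> {1..m}"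
  proof -
    \<comment> \<open>The part of the objective that depends on the model of client
      \<open>i\<close>, up to the weight \<open>p i\<close>.\<close>
    define f where "f x = emp_loss \<l> (n i) (S i) x + lam / 2 * ((wg - x) \<bullet> (wg - x))" for x
    let ?G = "gradient (emp_loss \<l> (n i) (S i)) (w i)"
    have "f (w i) \<le> f x" for x
    proof -
      have "objective \<l> m n p lam S (wg, w(i := x)) = p i * f x +
          (\<Sum>k\<in>{1..m} - {i}. p k * (emp_loss \<l> (n k) (S k) (w k) + lam / 2 * (norm (wg - w k))\<^sup>2))" for x
        using i by (simp add: objective_def sum.remove[of _ i] f_def power2_norm_eq_inner)
      from this[of x] this[of "w i"] have "p i * f (w i) \<le> p i * f x"
        using opt[of "(wg, w(i := x))"] by simp
      then show ?thesis using p[OF i] by simp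
    qed
    moreover have "(f has_derivative (\<lambda>h. h \<bullet> ?G + lam / 2 * ((wg - w i) \<bullet> (- h) + (- h) \<bullet> (wg - w i)))) (at (w i))"
      unfolding f_def
      by (intro has_derivative_add has_derivative_mult_right has_derivative_inner
            GDERIV_gradient[OF diff[OF i], unfolded gderiv_def])
         (auto intro!: derivative_eq_intros)
    ultimately have "(\<lambda>h. h \<bullet> ?G + lam / 2 * ((wg - w i) \<bullet> (- h) + (- h) \<bullet> (wg - w i))) = (\<lambda>h. 0)"
      by (intro differential_zero_maxmin[where S = UNIV]) auto
    then have "h \<bullet> ?G + lam / 2 * ((wg - w i) \<bullet> (- h) + (- h) \<bullet> (wg - w i)) = 0" for h
      by meson
    then have "h \<bullet> ?G = h \<bullet> (lam *\<^sub>R (wg - w i))" for h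
      by (simp add: inner_commute[of "wg - w i"])
    then show ?thesis by (metis vector_eq_ldot)
  qed
  define f where "f x = (\<Sum>i = 1..m. p i * (emp_loss \<l> (n i) (S i) (w i) + lam / 2 * ((x - w i) \<bullet> (x - w i))))" for x
  \<comment> \<open>Also the direction in which the vanishing derivative at \<open>wg\<close> is
    evaluated; its value there is \<open>V \<bullet> V\<close>.\<close>
  define V where "V = lam *\<^sub>R (\<Sum>i = 1..m. p i *\<^sub>R (wg - w i))"
  have "f wg \<le> f x" for x
    using opt[of "(x, w)"] by (simp add: objective_def f_def power2_norm_eq_inner)
  moreover have "(f has_derivative (\<lambda>h. \<Sum>i = 1..m. p i * (0 + lam / 2 * ((wg - w i) \<bullet> h + h \<bullet> (wg - w i))))) (at wg)"
    unfolding f_def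
    by (intro has_derivative_sum has_derivative_add has_derivative_mult_right has_derivative_inner
          has_derivative_const)
       (auto intro!: derivative_eq_intros)
  ultimately have "(\<lambda>h. \<Sum>i = 1..m. p i * (0 + lam / 2 * ((wg - w i) \<bullet> h + h \<bullet> (wg - w i)))) = (\<lambda>h. 0)"
    by (intro differential_zero_maxmin[where S = UNIV]) auto
  then have "(\<Sum>i = 1..m. p i * (0 + lam / 2 * ((wg - w i) \<bullet> V + V \<bullet> (wg - w i)))) = 0"
    by meson
  also have "(\<Sum>i = 1..m. p i * (0 + lam / 2 * ((wg - w i) \<bullet> V + V \<bullet> (wg - w i)))) = V \<bullet> V"
  proof -
    have "V \<bullet> V = (\<Sum>i = 1..m. lam * (p i * ((wg - w i) \<bullet> V)))"
      by (subst (1) V_def) (simp only: inner_scaleR_left inner_sum_left sum_distrib_left)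
    also have "\<dots> = (\<Sum>i = 1..m. p i * (0 + lam / 2 * ((wg - w i) \<bullet> V + V \<bullet> (wg - w i))))"
      by (intro sum.cong refl) (simp add: inner_commute[of V])
    finally show ?thesis ..
  qed
  finally show "lam *\<^sub>R (\<Sum>i = 1..m. p i *\<^sub>R (wg - w i)) = 0"
    by (simp only: inner_eq_zero_iff V_def)
qed

subsection \<open>The function \<open>q\<^sub>1\<close> and the rates\<close>

lemma g_fun_nonneg:
  assumes "0 < \<mu>" "0 \<le> L" "0 \<le> lam"
  shows "0 \<le> g_fun \<mu> L lam"
  using assms by (simp add: g_fun_def)

lemma g_fun_antimono:
  assumes "0 < \<mu>" "0 \<le> L" "0 \<le> x" "x \<le> y"
  shows "g_fun \<mu> L y \<le> g_fun \<mu> L x"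
  unfolding g_fun_def using assms
  by (intro mult_left_mono add_mono divide_left_mono power_mono) auto

text \<open>The map from \<open>g\<close> to \<open>g / (1 - 4 * L\<^sup>2 * g)\<close> increases
  while the denominator is positive, and \<open>g_fun\<close> decreases in \<open>lam\<close>. All
  factors are nonnegative, so the comparison passes through the products.\<close>

lemma q1_recip_antimono:
  assumes mu: "0 < \<mu>" and L: "0 \<le> L" and x: "x \<in> q1_domain \<mu> L" and xy: "x \<le> y"
  shows "q1_recip \<mu> L R \<rho> n N y \<le> q1_recip \<mu> L R \<rho> n N x"
proof -
  have x0: "0 \<le> x" and gx: "4 * L\<^sup>2 * g_fun \<mu> L x < 1" using x by (auto simp: q1_domain_def)
  have gyx: "g_fun \<mu> L y \<le> g_fun \<mu> L x" using g_fun_antimono[OF mu L x0 xy] .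
  have gy: "0 \<le> g_fun \<mu> L y" using g_fun_nonneg[OF mu L] x0 xy by simp
  have "4 * L\<^sup>2 * g_fun \<mu> L y \<le> 4 * L\<^sup>2 * g_fun \<mu> L x" using gyx by (intro mult_left_mono) auto
  then have d: "0 < 1 - 4 * L\<^sup>2 * g_fun \<mu> L x"
    "1 - 4 * L\<^sup>2 * g_fun \<mu> L x \<le> 1 - 4 * L\<^sup>2 * g_fun \<mu> L y"
    using gx by auto
  have h: "g_fun \<mu> L y / (1 - 4 * L\<^sup>2 * g_fun \<mu> L y) \<le> g_fun \<mu> L x / (1 - 4 * L\<^sup>2 * g_fun \<mu> L x)"
    using gyx gy d by (intro frac_le) auto
  have h3: "3 * g_fun \<mu> L y / (1 - 4 * L\<^sup>2 * g_fun \<mu> L y) \<le> 3 * g_fun \<mu> L x / (1 - 4 * L\<^sup>2 * g_fun \<mu> L x)"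
    using gyx gy d by (intro frac_le) auto
  have c: "c / (\<mu> + y)\<^sup>2 \<le> c / (\<mu> + x)\<^sup>2" if "0 \<le> c" for c
    using that mu x0 xy by (intro divide_left_mono power_mono) auto
  have hy: "0 \<le> g_fun \<mu> L y / (1 - 4 * L\<^sup>2 * g_fun \<mu> L y)"
    using gy d by (intro divide_nonneg_nonneg) auto
  have c0: "0 \<le> c / (\<mu> + x)\<^sup>2" if "0 \<le> c" for c
    using that by simp
  have A: "0 \<le> 4 * L\<^sup>2 * R\<^sup>2 + 2 * (\<rho>\<^sup>2 / real n)"
    and B: "0 \<le> 2 * (8 * \<rho>\<^sup>2 / \<mu>\<^sup>2 * (1 / real N) + 8 * L\<^sup>2 / \<mu>\<^sup>2 * R\<^sup>2)" by simp_all
  have L48: "0 \<le> 48 * L\<^sup>2" by simp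
  show ?thesis
    unfolding q1_recip_def
    by (intro add_mono mult_mono mult_right_mono c c0 h h3 order_refl
        add_nonneg_nonneg[OF mult_nonneg_nonneg[OF hy A] B] A L48 zero_le_numeral)
qed

lemma q1_recip_nonneg:
  assumes mu: "0 < \<mu>" and L: "0 \<le> L" and x: "x \<in> q1_domain \<mu> L"
  shows "0 \<le> q1_recip \<mu> L R \<rho> n N x"
proof -
  have "0 \<le> x" and gx: "4 * L\<^sup>2 * g_fun \<mu> L x < 1" using x by (auto simp: q1_domain_def)
  then have "0 \<le> g_fun \<mu> L x" using g_fun_nonneg[OF mu L] by simp
  then show ?thesis
    unfolding q1_recip_def using gx
    by (intro add_nonneg_nonneg mult_nonneg_nonneg divide_nonneg_nonneg) auto
qed

lemma tendsto_inverse_shift_at_top: "((\<lambda>x::real. inverse (\<mu> + x)) \<longlongrightarrow> 0) at_top"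
  by (intro tendsto_inverse_0_at_top filterlim_tendsto_add_at_top[OF tendsto_const] filterlim_ident)

lemma tendsto_g_fun: "(g_fun \<mu> L \<longlongrightarrow> 0) at_top"
proof -
  have "((\<lambda>x. 4 / \<mu> * (inverse (\<mu> + x) + L * (inverse (\<mu> + x))\<^sup>2)) \<longlongrightarrow> 4 / \<mu> * (0 + L * 0\<^sup>2)) at_top"
    by (intro tendsto_intros tendsto_inverse_shift_at_top)
  then show ?thesis by (simp add: g_fun_def[abs_def] divide_inverse power_inverse)
qed

lemma tendsto_q1_recip: "(q1_recip \<mu> L R \<rho> n N \<longlongrightarrow> 0) at_top"
proof -
  define A B where "A = 4 * L\<^sup>2 * R\<^sup>2 + 2 * (\<rho>\<^sup>2 / real n)"
    and "B = 2 * (8 * \<rho>\<^sup>2 / \<mu>\<^sup>2 * (1 / real N) + 8 * L\<^sup>2 / \<mu>\<^sup>2 * R\<^sup>2)"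
  have "((\<lambda>x. 12 * (inverse (\<mu> + x))\<^sup>2 * A
      + 48 * L\<^sup>2 * (inverse (\<mu> + x))\<^sup>2 * (g_fun \<mu> L x / (1 - 4 * L\<^sup>2 * g_fun \<mu> L x) * A + B)
      + 3 * g_fun \<mu> L x / (1 - 4 * L\<^sup>2 * g_fun \<mu> L x) * A)
    \<longlongrightarrow> 12 * 0\<^sup>2 * A + 48 * L\<^sup>2 * 0\<^sup>2 * (0 / (1 - 4 * L\<^sup>2 * 0) * A + B)
      + 3 * 0 / (1 - 4 * L\<^sup>2 * 0) * A) at_top"
    by (intro tendsto_intros tendsto_inverse_shift_at_top tendsto_g_fun) auto
  then show ?thesis
    by (simp add: q1_recip_def[abs_def] A_def B_def divide_inverse power_inverse)
qed

text \<open>A reciprocal tending to 0 could still be negative; eventually \<open>lam\<close> lies in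
  the domain, where it is nonnegative. If it equals 0, its extended inverse is already
  infinite.\<close>

lemma tendsto_q1:
  assumes mu: "0 < \<mu>" and L: "0 \<le> L"
  shows "(q1 \<mu> L R \<rho> n N \<longlongrightarrow> \<infinity>) at_top"
  unfolding tendsto_PInfty
proof
  fix r :: real
  have "((\<lambda>x. 4 * L\<^sup>2 * g_fun \<mu> L x) \<longlongrightarrow> 4 * L\<^sup>2 * 0) at_top"
    by (intro tendsto_intros tendsto_g_fun)
  then have dom: "eventually (\<lambda>x. 4 * L\<^sup>2 * g_fun \<mu> L x < 1) at_top"
    by (rule order_tendstoD) simp
  have small: "eventually (\<lambda>x. q1_recip \<mu> L R \<rho> n N x < 1 / (\<bar>r\<bar> + 1)) at_top"
    using tendsto_q1_recip by (rule order_tendstoD) simp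
  show "eventually (\<lambda>x. ereal r < q1 \<mu> L R \<rho> n N x) at_top"
    using dom small eventually_ge_at_top[of 0]
  proof eventually_elim
    case (elim x)
    let ?q = "q1_recip \<mu> L R \<rho> n N x"
    have "0 \<le> ?q" using elim by (intro q1_recip_nonneg[OF mu L]) (simp add: q1_domain_def)
    then consider "?q = 0" | "0 < ?q" by linarith
    then show ?case
    proof cases
      case 2
      then have "(\<bar>r\<bar> + 1) * ?q < 1" using elim(2) by (simp add: field_simps)
      then have "\<bar>r\<bar> * ?q + ?q < 1" by (simp add: distrib_right)
      moreover have "r * ?q \<le> \<bar>r\<bar> * ?q" using 2 by (intro mult_right_mono) auto
      ultimately have "r * ?q < 1" using 2 by linarith
      then have "r < inverse ?q" using 2 by (simp add: field_simps)
      then show ?thesis using 2 by (simp add: q1_def)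
    qed (simp add: q1_def)
  qed
qed

lemma mono_on_q1:
  assumes mu: "0 < \<mu>" and L: "0 \<le> L"
  shows "mono_on (q1_domain \<mu> L) (q1 \<mu> L R \<rho> n N)"
proof (rule mono_onI)
  fix x y assume "x \<in> q1_domain \<mu> L" "y \<in> q1_domain \<mu> L" "x \<le> y"
  then show "q1 \<mu> L R \<rho> n N x \<le> q1 \<mu> L R \<rho> n N y"
    unfolding q1_def using q1_recip_antimono[OF mu L] q1_recip_nonneg[OF mu L]
    by (intro ereal_inverse_antimono) simp_all
qed

text \<open>The first summand of \<open>g_fun\<close> is \<open>4 / (\<mu> * (\<mu> + lam))\<close>,
  so membership in the domain bounds \<open>L\<^sup>2 / (\<mu> * (\<mu> + lam))\<close> by
  \<open>1 / 16\<close>. Using that bound once in the square of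
  \<open>L / (\<mu> * (\<mu> + lam))\<close> gives the second claim.\<close>

lemma q1_domain_contraction:
  assumes mu: "0 < \<mu>" and L: "0 \<le> L" and lam: "lam \<in> q1_domain \<mu> L"
  shows "L / (\<mu> * (\<mu> + lam)) * L \<le> 1 / 16"
    and "64 * (L / (\<mu> * (\<mu> + lam)))\<^sup>2 \<le> g_fun \<mu> L lam / (1 - 4 * L\<^sup>2 * g_fun \<mu> L lam)"
proof -
  have lam0: "0 \<le> lam" and g1: "4 * L\<^sup>2 * g_fun \<mu> L lam < 1"
    using lam by (auto simp: q1_domain_def)
  define c where "c = 1 / (\<mu> * (\<mu> + lam))"
  have c: "0 \<le> c" using mu lam0 by (simp add: c_def)
  have g: "4 * c \<le> g_fun \<mu> L lam"
    using mu lam0 L by (simp add: c_def g_fun_def distrib_left)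
  have "4 * L\<^sup>2 * (4 * c) \<le> 4 * L\<^sup>2 * g_fun \<mu> L lam" using g by (intro mult_left_mono) auto
  also have "\<dots> < 1" by (rule g1)
  finally have Lc: "L\<^sup>2 * c \<le> 1 / 16" by simp
  then show "L / (\<mu> * (\<mu> + lam)) * L \<le> 1 / 16"
    by (simp add: c_def power2_eq_square)
  have "64 * (L / (\<mu> * (\<mu> + lam)))\<^sup>2 = 64 * (L\<^sup>2 * c) * c"
    by (simp add: c_def power2_eq_square)
  also have "\<dots> \<le> 64 * (1 / 16) * c" using Lc c by (intro mult_right_mono mult_left_mono) auto
  also have "\<dots> = 4 * c" by simp
  also have "\<dots> \<le> g_fun \<mu> L lam" by (rule g)
  also have "\<dots> \<le> g_fun \<mu> L lam / (1 - 4 * L\<^sup>2 * g_fun \<mu> L lam)"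
  proof -
    have "0 \<le> g_fun \<mu> L lam" using g c by simp
    then have "g_fun \<mu> L lam * (1 - 4 * L\<^sup>2 * g_fun \<mu> L lam) \<le> g_fun \<mu> L lam * 1"
      by (intro mult_left_mono) auto
    then show ?thesis using g1 by (simp add: pos_le_divide_eq)
  qed
  finally show "64 * (L / (\<mu> * (\<mu> + lam)))\<^sup>2 \<le> g_fun \<mu> L lam / (1 - 4 * L\<^sup>2 * g_fun \<mu> L lam)" .
qed

lemma consensus_rate_le:
  fixes a \<mu> L lam :: real
  defines "a \<equiv> L / (\<mu> * (\<mu> + lam))"
  assumes mu: "0 < \<mu>" and L: "0 \<le> L" and lam: "lam \<in> q1_domain \<mu> L"
    and y: "y \<le> 5 * (a\<^sup>2 * (\<rho>\<^sup>2 / real n) + a\<^sup>2 * (L\<^sup>2 * R\<^sup>2) + \<rho>\<^sup>2 / real N / \<mu>\<^sup>2 + L\<^sup>2 * R\<^sup>2 / \<mu>\<^sup>2)"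
  shows "3 * R\<^sup>2 + 3 * y + 9 / (\<mu> + lam)\<^sup>2 * (\<rho>\<^sup>2 / real n + L\<^sup>2 * R\<^sup>2 + L\<^sup>2 * y)
    \<le> 48 * \<rho>\<^sup>2 / \<mu>\<^sup>2 * (1 / real N) + (48 * L\<^sup>2 / \<mu>\<^sup>2 + 3) * R\<^sup>2 + q1_recip \<mu> L R \<rho> n N lam"
proof -
  define h where "h = g_fun \<mu> L lam / (1 - 4 * L\<^sup>2 * g_fun \<mu> L lam)"
  define r c s where "r = \<rho>\<^sup>2 / real n" and "c = L\<^sup>2 * R\<^sup>2" and "s = \<rho>\<^sup>2 / real N / \<mu>\<^sup>2 + L\<^sup>2 * R\<^sup>2 / \<mu>\<^sup>2"
  \<comment> \<open>\<open>X\<close> is the square bracket in the second term of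
    \<open>q1_recip\<close>. It dominates \<open>y\<close>; then \<open>3 * X\<close> supplies the
    last term of \<open>q1_recip\<close> and the terms \<open>48 * s\<close> outside it, while
    \<open>k * 48 * L\<^sup>2 * X\<close> is the second term.\<close>
  define X k where "X = h * (4 * c + 2 * r) + 16 * s" and "k = 1 / (\<mu> + lam)\<^sup>2"
  have nonneg: "0 \<le> r" "0 \<le> c" "0 \<le> s" "0 \<le> k" by (auto simp: r_def c_def s_def k_def)
  have a: "64 * a\<^sup>2 \<le> h" using q1_domain_contraction(2)[OF mu L lam] by (simp add: a_def h_def)
  then have h: "0 \<le> h" using zero_le_power2[of a] by linarith
  have "y \<le> 5 * (a\<^sup>2 * (r + c)) + 5 * s" using y by (simp add: r_def c_def s_def distrib_left)
  also have "5 * (a\<^sup>2 * (r + c)) \<le> h * (r + c)"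
  proof -
    have "5 * a\<^sup>2 \<le> h" using a zero_le_power2[of a] by linarith
    then have "5 * a\<^sup>2 * (r + c) \<le> h * (r + c)" using nonneg by (intro mult_right_mono) auto
    then show ?thesis by (simp only: mult.assoc)
  qed
  also have "h * (r + c) \<le> h * (4 * c + 2 * r)" using h nonneg by (intro mult_left_mono) auto
  finally have yX: "y \<le> X" using nonneg by (simp add: X_def)
  then have "L\<^sup>2 * y \<le> L\<^sup>2 * X" by (intro mult_left_mono) auto
  moreover have "0 \<le> L\<^sup>2 * X" using h nonneg by (simp add: X_def)
  moreover have "9 * (r + c + u) \<le> 12 * (4 * c + 2 * r) + 48 * t" if "u \<le> t" "0 \<le> t" for u t
    using nonneg that by simp
  ultimately have "9 * (r + c + L\<^sup>2 * y) \<le> 12 * (4 * c + 2 * r) + 48 * (L\<^sup>2 * X)" by blast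
  then have "k * (9 * (r + c + L\<^sup>2 * y)) \<le> k * (12 * (4 * c + 2 * r) + 48 * (L\<^sup>2 * X))"
    using nonneg(4) by (rule mult_left_mono)
  with yX have "3 * R\<^sup>2 + 3 * y + k * (9 * (r + c + L\<^sup>2 * y))
      \<le> 3 * R\<^sup>2 + 3 * X + k * (12 * (4 * c + 2 * r) + 48 * (L\<^sup>2 * X))" by linarith
  also have "\<dots> = 48 * s + 3 * R\<^sup>2 + (12 * k * (4 * c + 2 * r) + 48 * L\<^sup>2 * k * (h * (4 * c + 2 * r) + 16 * s)
      + 3 * h * (4 * c + 2 * r))"
    by (simp add: X_def algebra_simps)
  also have "12 * k * (4 * c + 2 * r) + 48 * L\<^sup>2 * k * (h * (4 * c + 2 * r) + 16 * s)
      + 3 * h * (4 * c + 2 * r) = q1_recip \<mu> L R \<rho> n N lam"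
  proof -
    have "12 * k = 12 / (\<mu> + lam)\<^sup>2" "48 * L\<^sup>2 * k = 48 * L\<^sup>2 / (\<mu> + lam)\<^sup>2"
      "3 * h = 3 * g_fun \<mu> L lam / (1 - 4 * L\<^sup>2 * g_fun \<mu> L lam)"
      "4 * c + 2 * r = 4 * L\<^sup>2 * R\<^sup>2 + 2 * (\<rho>\<^sup>2 / real n)"
      "16 * s = 2 * (8 * \<rho>\<^sup>2 / \<mu>\<^sup>2 * (1 / real N) + 8 * L\<^sup>2 / \<mu>\<^sup>2 * R\<^sup>2)"
      by (simp_all add: k_def h_def c_def r_def s_def distrib_left mult_ac)
    then show ?thesis by (simp only: q1_recip_def h_def)
  qed
  also have "48 * s + 3 * R\<^sup>2 = 48 * \<rho>\<^sup>2 / \<mu>\<^sup>2 * (1 / real N) + (48 * L\<^sup>2 / \<mu>\<^sup>2 + 3) * R\<^sup>2"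
    by (simp add: s_def algebra_simps)
  finally show ?thesis by (simp add: k_def r_def c_def)
qed

lemma local_rate_le:
  assumes mu: "0 < \<mu>" and lam: "0 \<le> lam"
  shows "(2 * (lam\<^sup>2 * R\<^sup>2) + 2 * (\<rho>\<^sup>2 / real n)) / \<mu>\<^sup>2
    \<le> 4 * \<rho>\<^sup>2 / \<mu>\<^sup>2 * (1 / real n)
      + ((4 * \<rho>\<^sup>2 / \<mu> ^ 3 * (1 / real n) + 4 / \<mu> * R\<^sup>2) * lam + 8 / \<mu>\<^sup>2 * R\<^sup>2 * lam\<^sup>2)"
proof -
  define r where "r = \<rho>\<^sup>2 / real n / \<mu>\<^sup>2"
  define b where "b = R\<^sup>2 * lam\<^sup>2 / \<mu>\<^sup>2"
  have "0 \<le> (4 * \<rho>\<^sup>2 / \<mu> ^ 3 * (1 / real n) + 4 / \<mu> * R\<^sup>2) * lam"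
    using assms by (intro mult_nonneg_nonneg add_nonneg_nonneg) auto
  moreover have "0 \<le> r" "0 \<le> b" by (auto simp: r_def b_def)
  moreover have "(2 * (lam\<^sup>2 * R\<^sup>2) + 2 * (\<rho>\<^sup>2 / real n)) / \<mu>\<^sup>2 = 2 * b + 2 * r"
    by (simp add: b_def r_def add_divide_distrib mult_ac)
  moreover have "4 * \<rho>\<^sup>2 / \<mu>\<^sup>2 * (1 / real n) = 4 * r" "8 / \<mu>\<^sup>2 * R\<^sup>2 * lam\<^sup>2 = 8 * b"
    by (simp_all add: b_def r_def mult_ac)
  ultimately show ?thesis by linarith
qed

text \<open>The local models are an arbitrary selection of minimisers, so their error may fail to be
  measurable in the sample. The nonnegative integral is monotone regardless; only the dominating
  \<open>K\<close> has to be integrable.\<close>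

lemma nn_integral_le_integral_bound:
  fixes f K :: "'a \<Rightarrow> real"
  assumes int: "integrable M K" and le: "AE x in M. f x \<le> K x" and nonneg: "\<And>x. 0 \<le> f x"
    and B: "integral\<^sup>L M K \<le> B"
  shows "(\<integral>\<^sup>+ x. ennreal (f x) \<partial>M) \<le> ennreal B"
proof -
  have "(\<integral>\<^sup>+ x. ennreal (f x) \<partial>M) \<le> (\<integral>\<^sup>+ x. ennreal (K x) \<partial>M)"
    using le by (intro nn_integral_mono_AE) (auto intro: ennreal_leI elim: eventually_mono)
  also have "\<dots> = ennreal (integral\<^sup>L M K)"
    using int le by (intro nn_integral_eq_integral) (auto intro: order_trans[OF nonneg] elim: eventually_mono)
  also have "\<dots> \<le> ennreal B" using B by (rule ennreal_leI)
  finally show ?thesis .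
qed

subsection \<open>The expected error\<close>

theorem theorem1:
  fixes \<l> :: "real ^ 'd \<Rightarrow> 'z \<Rightarrow> real"
    and Z :: "'z measure" and D :: "nat \<Rightarrow> 'z measure"
    and P :: "'o measure" and z :: "nat \<Rightarrow> nat \<Rightarrow> 'o \<Rightarrow> 'z"
    and m n N :: nat and p :: "nat \<Rightarrow> real"
    and \<mu> L \<rho> R lam :: real
    and wstar :: "nat \<Rightarrow> real ^ 'd"
    and wg :: "'o \<Rightarrow> real ^ 'd" and w :: "'o \<Rightarrow> nat \<Rightarrow> real ^ 'd"
  assumes m: "m \<ge> 1" and n: "n \<ge> 1" and N: "N = m * n"
    and p: "\<And>i. i \<in> {1..m} \<Longrightarrow> p i = 1 / real m"
    and lam: "0 \<le> lam"
    \<comment> \<open>the data: independent, with \<open>z i j\<close> distributed according to \<open>D i\<close>\<close>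
    and P: "prob_space P"
    and indep: "prob_space.indep_vars P (\<lambda>_. Z) (\<lambda>(i, j). z i j) ({1..m} \<times> {1..n})"
    and distr: "\<And>i j. i \<in> {1..m} \<Longrightarrow> j \<in> {1..n} \<Longrightarrow> distr P Z (z i j) = D i"
    \<comment> \<open>the loss and the ground truth models\<close>
    and diff: "\<And>x s. s \<in> space Z \<Longrightarrow> (\<lambda>v. \<l> v s) differentiable (at x)"
    and intg: "\<And>i x. i \<in> {1..m} \<Longrightarrow> integrable (D i) (\<l> x)"
    and wstar: "\<And>i. i \<in> {1..m} \<Longrightarrow> is_arg_min (pop_loss \<l> (D i)) (\<lambda>_. True) (wstar i)"
    and wstar_space: "wstar \<in> param_space m p R"
    \<comment> \<open>smoothness\<close>
    and A1: "\<And>x y s. s \<in> space Z \<Longrightarrow>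
       norm (gradient (\<lambda>v. \<l> v s) x - gradient (\<lambda>v. \<l> v s) y) \<le> L * norm (x - y)"
    \<comment> \<open>strong convexity of the empirical losses\<close>
    and mu: "0 < \<mu>"
    and A2: "AE \<omega> in P. \<forall>i\<in>{1..m}. strongly_convex \<mu> (emp_loss \<l> n (\<lambda>j. z i j \<omega>))"
    \<comment> \<open>bounded gradient variance at the ground truth\<close>
    and rho: "0 \<le> \<rho>"
    and A3: "\<And>i. i \<in> {1..m} \<Longrightarrow>
       (\<integral>\<^sup>+ s. ennreal ((norm (gradient (\<lambda>v. \<l> v s) (wstar i)))\<^sup>2) \<partial>D i) \<le> ennreal (\<rho>\<^sup>2)"
    and sol: "AE \<omega> in P.
       is_solution \<l> m (\<lambda>_. n) p lam (\<lambda>i j. z i j \<omega>) (wg \<omega>) (w \<omega>)"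
  defines "B1 \<equiv> 48 * \<rho>\<^sup>2 / \<mu>\<^sup>2 * (1 / real N) + (48 * L\<^sup>2 / \<mu>\<^sup>2 + 3) * R\<^sup>2
                 + q1_recip \<mu> L R \<rho> n N lam"
    and "B2 \<equiv> 4 * \<rho>\<^sup>2 / \<mu>\<^sup>2 * (1 / real n)
                 + ((4 * \<rho>\<^sup>2 / \<mu> ^ 3 * (1 / real n) + 4 / \<mu> * R\<^sup>2) * lam
                    + 8 / \<mu>\<^sup>2 * R\<^sup>2 * lam\<^sup>2)"
  shows "(\<forall>i\<in>{1..m}.
            (\<integral>\<^sup>+ \<omega>. ennreal ((norm (w \<omega> i - wstar i))\<^sup>2) \<partial>P)
              \<le> ennreal (if lam \<in> q1_domain \<mu> L then min B1 B2 else B2))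
       \<and> mono_on (q1_domain \<mu> L) (q1 \<mu> L R \<rho> n N)
       \<and> (q1 \<mu> L R \<rho> n N \<longlongrightarrow> \<infinity>) at_top"
proof -

  \<comment> \<open>Moments of the loss gradient at the ground truth\<close>
  interpret prob_space P by fact
  define H where "H i s = gradient (\<lambda>v. \<l> v s) (wstar i)" for i s
  define G where "G i \<omega> = gradient (emp_loss \<l> n (\<lambda>j. z i j \<omega>)) (wstar i)" for i \<omega>
  define r where "r = \<rho>\<^sup>2 / real n"
  have z: "z i j \<in> measurable P Z" if "i \<in> {1..m}" "j \<in> {1..n}" for i j
    using indep that by (auto simp: indep_vars_def)
  obtain \<omega>\<^sub>0 where "\<omega>\<^sub>0 \<in> space P" using not_empty by blast
  then have s\<^sub>0: "z 1 1 \<omega>\<^sub>0 \<in> space Z" using z[of 1 1] m n by (auto dest: measurable_space)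
  \<comment> \<open>A1 at one actual data point, applied to a unit vector and 0, yields the sign of
    \<open>L\<close>.\<close>
  have L: "0 \<le> L"
  proof -
    obtain b :: "real ^ 'd" where "b \<in> Basis" using nonempty_Basis by blast
    then have "norm (b - 0) = 1" by simp
    then show ?thesis using order_trans[OF norm_ge_zero A1[OF s\<^sub>0, of b 0]] by simp
  qed
  have D_eq: "D i = distr P Z (z i 1)" if "i \<in> {1..m}" for i
    using distr[of i 1] that n by simp
  have sets_D: "sets (D i) = sets Z" and space_D: "space (D i) = space Z"
    and prob_D: "prob_space (D i)" if "i \<in> {1..m}" for i
    unfolding D_eq[OF that] using z[OF that, of 1] n by (auto intro!: prob_space_distr)
  have H_meas: "H i \<in> borel_measurable Z" if i: "i \<in> {1..m}" for i
  proof -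
    have "H i \<in> borel_measurable (D i)"
      unfolding H_def using diff intg[OF i] space_D[OF i]
      by (intro borel_measurable_gradient) auto
    then show ?thesis by (simp add: measurable_cong_sets[OF sets_D[OF i] refl])
  qed
  have H_meas_D: "H i \<in> borel_measurable (D i)" if i: "i \<in> {1..m}" for i
    using H_meas[OF i] by (simp add: measurable_cong_sets[OF sets_D[OF i] refl])
  have H_sq: "integrable (D i) (\<lambda>s. (norm (H i s))\<^sup>2)"
    and H_le: "(\<integral>s. (norm (H i s))\<^sup>2 \<partial>D i) \<le> \<rho>\<^sup>2" if i: "i \<in> {1..m}" for i
  proof -
    have fin: "(\<integral>\<^sup>+ s. ennreal ((norm (H i s))\<^sup>2) \<partial>D i) \<le> ennreal (\<rho>\<^sup>2)"
      unfolding H_def by (rule A3[OF i])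
    also have "\<dots> < \<infinity>" by simp
    finally show int: "integrable (D i) (\<lambda>s. (norm (H i s))\<^sup>2)"
      using H_meas_D[OF i] by (intro integrableI_nonneg) auto
    show "(\<integral>s. (norm (H i s))\<^sup>2 \<partial>D i) \<le> \<rho>\<^sup>2"
      using fin by (simp add: nn_integral_eq_integral[OF int])
  qed
  have H_zero: "(\<integral>s. H i s \<partial>D i) = 0" if i: "i \<in> {1..m}" for i
  proof -
    have "(\<lambda>s. norm (H i s)) \<in> borel_measurable (D i)"
      using H_meas_D[OF i] by simp
    with prob_space.finite_measure[OF prob_D[OF i]] have "integrable (D i) (\<lambda>s. norm (H i s))"
      using H_sq[OF i] by (rule finite_measure.square_integrable_imp_integrable)
    then have "integrable (D i) (H i)" using integrable_norm_iff[OF H_meas_D[OF i]] by blast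
    then show ?thesis
      unfolding H_def
      by (intro prob_space.integral_gradient_pop_loss_minimizer[OF prob_D[OF i] _ intg[OF i] _ L wstar[OF i]])
         (simp_all add: diff A1 space_D[OF i])
  qed

  \<comment> \<open>Independent centred gradient samples\<close>
  define X where "X = (\<lambda>(i, j) \<omega>. H i (z i j \<omega>))"
  let ?A = "{1..m} \<times> {1..n}"
  have X_indep: "indep_vars (\<lambda>_. borel) X ?A"
  proof -
    have "indep_vars (\<lambda>_. borel) (\<lambda>a \<omega>. H (fst a) ((\<lambda>(i, j). z i j) a \<omega>)) ?A"
      using indep by (rule indep_vars_compose2) (use H_meas in auto)
    then show ?thesis by (simp add: X_def case_prod_beta')
  qed
  have X_sq: "integrable P (\<lambda>\<omega>. (norm (X a \<omega>))\<^sup>2)" and X_zero: "expectation (X a) = 0"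
    and X_le: "expectation (\<lambda>\<omega>. (norm (X a \<omega>))\<^sup>2) \<le> \<rho>\<^sup>2" if a: "a \<in> ?A" for a
  proof -
    obtain i j where ij: "a = (i, j)" "i \<in> {1..m}" "j \<in> {1..n}" using a by auto
    note D = distr[OF ij(2,3)] and meas = H_meas[OF ij(2)] z[OF ij(2,3)]
    have sq_meas: "(\<lambda>s. (norm (H i s))\<^sup>2) \<in> borel_measurable Z" using meas(1) by simp
    show "integrable P (\<lambda>\<omega>. (norm (X a \<omega>))\<^sup>2)"
      using H_sq[OF ij(2)] integrable_distr_eq[OF meas(2) sq_meas] by (simp add: D X_def ij(1))
    show "expectation (X a) = 0"
      using H_zero[OF ij(2)] integral_distr[OF meas(2,1)] by (simp add: D X_def ij(1))
    show "expectation (\<lambda>\<omega>. (norm (X a \<omega>))\<^sup>2) \<le> \<rho>\<^sup>2"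
      using H_le[OF ij(2)] integral_distr[OF meas(2) sq_meas] by (simp add: D X_def ij(1))
  qed
  \<comment> \<open>Used with one client's samples for the rate in \<open>n\<close>, and with all
    samples for the rate in \<open>N\<close>.\<close>
  have X_sum: "integrable P (\<lambda>\<omega>. (norm (\<Sum>a\<in>I. X a \<omega>))\<^sup>2)"
    "expectation (\<lambda>\<omega>. (norm (\<Sum>a\<in>I. X a \<omega>))\<^sup>2) \<le> real (card I) * \<rho>\<^sup>2" if I: "I \<subseteq> ?A" for I
    using expectation_norm_sum_indep_le[OF finite_subset[OF I] indep_vars_subset[OF X_indep I]
        X_sq[OF subsetD[OF I]] X_zero[OF subsetD[OF I]] X_le[OF subsetD[OF I]]] by auto

  \<comment> \<open>Empirical gradients as sample averages\<close>
  have emp_diff: "GDERIV (emp_loss \<l> n (\<lambda>j. z i j \<omega>)) x :>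
      (1 / real n) *\<^sub>R (\<Sum>j = 1..n. gradient (\<lambda>v. \<l> v (z i j \<omega>)) x)"
    if "i \<in> {1..m}" "\<omega> \<in> space P" for i \<omega> x
    using that z by (intro GDERIV_emp_loss diff) (auto dest: measurable_space)
  have G_eq: "G i \<omega> = (1 / real n) *\<^sub>R (\<Sum>a\<in>{i} \<times> {1..n}. X a \<omega>)"
    if "i \<in> {1..m}" "\<omega> \<in> space P" for i \<omega>
  proof -
    have "(\<Sum>a\<in>{i} \<times> {1..n}. X a \<omega>) = (\<Sum>j = 1..n. H i (z i j \<omega>))"
      using sum.cartesian_product[of "\<lambda>i j. H i (z i j \<omega>)" "{1..n}" "{i}"]
      by (simp add: X_def case_prod_beta')
    then show ?thesis
      unfolding G_def gradient_eq[OF emp_diff[OF that]] by (simp add: H_def)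
  qed
  have sum_G_eq: "(\<Sum>i = 1..m. G i \<omega>) = (1 / real n) *\<^sub>R (\<Sum>a\<in>?A. X a \<omega>)"
    if \<omega>: "\<omega> \<in> space P" for \<omega>
  proof -
    have "(\<Sum>a\<in>{i} \<times> {1..n}. X a \<omega>) = (\<Sum>j = 1..n. X (i, j) \<omega>)" for i
      using sum.cartesian_product[of "\<lambda>i j. X (i, j) \<omega>" "{1..n}" "{i}"] by simp
    then have "(\<Sum>i = 1..m. G i \<omega>) = (\<Sum>i = 1..m. (1 / real n) *\<^sub>R (\<Sum>j = 1..n. X (i, j) \<omega>))"
      by (intro sum.cong refl) (simp add: G_eq[OF _ \<omega>])
    also have "\<dots> = (1 / real n) *\<^sub>R (\<Sum>a\<in>?A. X a \<omega>)"
      by (simp add: sum.cartesian_product flip: scaleR_sum_right)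
    finally show ?thesis .
  qed
  have G_int: "integrable P (\<lambda>\<omega>. (norm (G i \<omega>))\<^sup>2)"
    and G_le: "expectation (\<lambda>\<omega>. (norm (G i \<omega>))\<^sup>2) \<le> r" if i: "i \<in> {1..m}" for i
  proof -
    have eq: "(norm (G i \<omega>))\<^sup>2 = (norm (\<Sum>a\<in>{i} \<times> {1..n}. X a \<omega>))\<^sup>2 / (real n)\<^sup>2" if "\<omega> \<in> space P" for \<omega>
      by (simp add: G_eq[OF i that] power_divide)
    have sub: "{i} \<times> {1..n} \<subseteq> ?A" using i by auto
    show "integrable P (\<lambda>\<omega>. (norm (G i \<omega>))\<^sup>2)"
      using X_sum(1)[OF sub] by (subst Bochner_Integration.integrable_cong[OF refl eq]) auto
    have "expectation (\<lambda>\<omega>. (norm (G i \<omega>))\<^sup>2)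
        = expectation (\<lambda>\<omega>. (norm (\<Sum>a\<in>{i} \<times> {1..n}. X a \<omega>))\<^sup>2) / (real n)\<^sup>2"
      by (subst Bochner_Integration.integral_cong[OF refl eq]) auto
    also have "\<dots> \<le> real n * \<rho>\<^sup>2 / (real n)\<^sup>2"
      using X_sum(2)[OF sub] by (intro divide_right_mono) (auto simp: card_cartesian_product)
    also have "\<dots> = r" using n by (simp add: r_def power2_eq_square)
    finally show "expectation (\<lambda>\<omega>. (norm (G i \<omega>))\<^sup>2) \<le> r" .
  qed
  define M where "M \<omega> = (\<Sum>k = 1..m. (norm (G k \<omega>))\<^sup>2) / real m" for \<omega>
  have M_int: "integrable P M" 
    unfolding M_def[abs_def] by (intro integrable_divide Bochner_Integration.integrable_sum G_int)
  have M_le: "expectation M \<le> r"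
  proof -
    have "expectation M = (\<Sum>k = 1..m. expectation (\<lambda>\<omega>. (norm (G k \<omega>))\<^sup>2)) / real m"
      unfolding M_def[abs_def]
      by (simp only: integral_divide_zero Bochner_Integration.integral_sum[OF G_int])
    also have "\<dots> \<le> (\<Sum>k = 1..m. r) / real m"
      using G_le by (intro divide_right_mono sum_mono) auto
    also have "\<dots> = r" using m by simp
    finally show ?thesis .
  qed
  \<comment> \<open>In contrast to \<open>M\<close>, the average is taken inside the norm, so
    independence across clients improves the bound from \<open>\<rho>\<^sup>2 / n\<close> to
    \<open>\<rho>\<^sup>2 / N\<close>.\<close>
  define T where "T \<omega> = (norm (\<Sum>i = 1..m. G i \<omega>) / real m)\<^sup>2" for \<omega>
  have T_eq: "T \<omega> = (norm (\<Sum>a\<in>?A. X a \<omega>))\<^sup>2 / (real N)\<^sup>2" if "\<omega> \<in> space P" for \<omega>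
    unfolding T_def sum_G_eq[OF that] by (simp add: N power_divide power_mult_distrib mult.commute)
  have T_int: "integrable P T"
    using X_sum(1)[of ?A] by (subst Bochner_Integration.integrable_cong[OF refl T_eq]) auto
  have T_le: "expectation T \<le> \<rho>\<^sup>2 / real N"
  proof -
    have "expectation T = expectation (\<lambda>\<omega>. (norm (\<Sum>a\<in>?A. X a \<omega>))\<^sup>2) / (real N)\<^sup>2"
      by (subst Bochner_Integration.integral_cong[OF refl T_eq]) auto
    also have "\<dots> \<le> real N * \<rho>\<^sup>2 / (real N)\<^sup>2"
      using X_sum(2)[of ?A] by (intro divide_right_mono) (auto simp: card_cartesian_product N)
    also have "\<dots> = \<rho>\<^sup>2 / real N" using m n by (simp add: N power2_eq_square)
    finally show ?thesis .
  qed

  \<comment> \<open>Almost sure stationarity of the solutions\<close>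
  define ubar where "ubar = (1 / real m) *\<^sub>R (\<Sum>i = 1..m. wstar i)"
  \<comment> \<open>The parameter space constrains only squares, so \<open>R\<close> may be negative
    and its absolute value is the radius.\<close>
  have wstar_near: "norm (wstar i - ubar) \<le> \<bar>R\<bar>" if i: "i \<in> {1..m}" for i
  proof -
    have "(\<Sum>k = 1..m. p k *\<^sub>R wstar k) = ubar"
      by (simp add: ubar_def scaleR_sum_right p)
    then have "(norm (wstar i - ubar))\<^sup>2 \<le> \<bar>R\<bar>\<^sup>2"
      using wstar_space i by (auto simp: param_space_def)
    then show ?thesis by (rule power2_le_imp_le) simp
  qed
  \<comment> \<open>The mean replaces \<open>wg\<close>, which is not determined when
    \<open>lam = 0\<close>; the first-order conditions only involve \<open>lam *\<^sub>R wg\<close>,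
    which equals \<open>lam *\<^sub>R v \<omega>\<close>.\<close>
  define v where "v \<omega> = (1 / real m) *\<^sub>R (\<Sum>i = 1..m. w \<omega> i)" for \<omega>
  have stationary: "AE \<omega> in P. regularized_stationary
      (\<lambda>i. gradient (emp_loss \<l> n (\<lambda>j. z i j \<omega>))) m \<mu> L lam \<bar>R\<bar> wstar (w \<omega>) ubar (v \<omega>)"
    using A2 sol AE_space
  proof eventually_elim
    case (elim \<omega>)
    let ?F = "\<lambda>i. gradient (emp_loss \<l> n (\<lambda>j. z i j \<omega>))"
    have "norm (?F i x - ?F i y) \<le> L * norm (x - y)" if i: "i \<in> {1..m}" for i x y
    proof -
      let ?g = "\<lambda>j. gradient (\<lambda>v. \<l> v (z i j \<omega>))"
      have "norm (\<Sum>j = 1..n. ?g j x - ?g j y) \<le> (\<Sum>j = 1..n. L * norm (x - y))"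
        using z[OF i] elim(3) by (intro sum_norm_le A1) (auto dest: measurable_space)
      then have "norm (\<Sum>j = 1..n. ?g j x - ?g j y) \<le> real n * (L * norm (x - y))" by simp
      moreover have "?F i x - ?F i y = (1 / real n) *\<^sub>R (\<Sum>j = 1..n. ?g j x - ?g j y)"
        unfolding gradient_eq[OF emp_diff[OF i elim(3)]] by (simp add: sum_subtractf scaleR_diff_right)
      ultimately show ?thesis using n by (simp add: field_simps)
    qed
    moreover have "?F i (w \<omega> i) = lam *\<^sub>R (v \<omega> - w \<omega> i)" if i: "i \<in> {1..m}" for i
    proof -
      have emp_differentiable: "emp_loss \<l> n (\<lambda>j. z i j \<omega>) differentiable (at x)"
        if "i \<in> {1..m}" for i x
        using emp_diff[OF that elim(3)] unfolding gderiv_def differentiable_def by blast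
      have p_pos: "0 < p i" if "i \<in> {1..m}" for i using p[OF that] m by simp
      note fo = solution_stationary[OF elim(2) emp_differentiable p_pos]
      have "(\<Sum>k = 1..m. p k *\<^sub>R (wg \<omega> - w \<omega> k)) = wg \<omega> - v \<omega>"
      proof -
        have "(\<Sum>k = 1..m. p k *\<^sub>R (wg \<omega> - w \<omega> k)) = (\<Sum>k = 1..m. (1 / real m) *\<^sub>R (wg \<omega> - w \<omega> k))"
          by (intro sum.cong refl) (simp add: p)
        also have "\<dots> = wg \<omega> - v \<omega>"
          using m by (simp add: v_def sum_subtractf sum_constant_scaleR scaleR_diff_right
              del: sum_constant flip: scaleR_sum_right)
        finally show ?thesis .
      qed
      then have "lam *\<^sub>R (wg \<omega> - v \<omega>) = 0" using fo(2) by simp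
      moreover have "lam *\<^sub>R (wg \<omega> - w \<omega> i) = lam *\<^sub>R (wg \<omega> - v \<omega>) + lam *\<^sub>R (v \<omega> - w \<omega> i)"
        by (simp flip: scaleR_add_right)
      ultimately show ?thesis using fo(1)[OF _ _ i] by simp
    qed
    ultimately show ?case
      using m mu L lam elim(1) wstar_near
      by unfold_locales
         (auto simp: v_def ubar_def intro: strongly_convex_gradient_monotone)
  qed

  \<comment> \<open>The second bound, for every \<open>lam\<close>\<close>
  have le_B2: "(\<integral>\<^sup>+ \<omega>. ennreal ((norm (w \<omega> i - wstar i))\<^sup>2) \<partial>P) \<le> ennreal B2"
    if i: "i \<in> {1..m}" for i
  proof (rule nn_integral_le_integral_bound)
    define t where "t = lam / (\<mu> + lam)"
    have t: "0 \<le> t" "t \<le> 1" using mu lam by (auto simp: t_def)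
    let ?K = "\<lambda>\<omega>. (2 * (lam\<^sup>2 * R\<^sup>2) + 2 * (t * M \<omega> + (1 - t) * (norm (G i \<omega>))\<^sup>2)) / \<mu>\<^sup>2"
    show "integrable P ?K" using M_int G_int[OF i] by auto
    show "AE \<omega> in P. (norm (w \<omega> i - wstar i))\<^sup>2 \<le> ?K \<omega>"
      using stationary
    proof eventually_elim
      case (elim \<omega>)
      from regularized_stationary.local_error_square_le[OF elim i] show ?case
        using mu by (simp add: t_def M_def G_def pos_le_divide_eq mult.commute)
    qed
    have "t * expectation M + (1 - t) * expectation (\<lambda>\<omega>. (norm (G i \<omega>))\<^sup>2) \<le> t * r + (1 - t) * r"
      using t M_le G_le[OF i] by (intro add_mono mult_left_mono) auto
    also have "\<dots> = r" by (simp add: algebra_simps)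
    finally have "expectation ?K \<le> (2 * (lam\<^sup>2 * R\<^sup>2) + 2 * r) / \<mu>\<^sup>2"
      using M_int G_int[OF i] by (simp add: prob_space divide_right_mono)
    also have "\<dots> \<le> B2"
      unfolding B2_def r_def by (rule local_rate_le[OF mu lam])
    finally show "expectation ?K \<le> B2" .
  qed simp

  \<comment> \<open>The first bound, on the domain of \<open>q1\<close>\<close>
  have le_B1: "(\<integral>\<^sup>+ \<omega>. ennreal ((norm (w \<omega> i - wstar i))\<^sup>2) \<partial>P) \<le> ennreal B1"
    if i: "i \<in> {1..m}" and dom: "lam \<in> q1_domain \<mu> L" for i
  proof (rule nn_integral_le_integral_bound)
    define a where "a = L / (\<mu> * (\<mu> + lam))"
    \<comment> \<open>An integrable majorant of the squared consensus error, which itself need not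
      be measurable.\<close>
    define Y where "Y \<omega> = 5 * (a\<^sup>2 * M \<omega> + a\<^sup>2 * (L\<^sup>2 * R\<^sup>2) + T \<omega> / \<mu>\<^sup>2 + L\<^sup>2 * R\<^sup>2 / \<mu>\<^sup>2)" for \<omega>
    define k where "k = 9 / (\<mu> + lam)\<^sup>2"
    have k: "0 \<le> k" by (simp add: k_def)
    have Y_int: "integrable P Y" unfolding Y_def[abs_def] using M_int T_int by auto
    let ?K = "\<lambda>\<omega>. 3 * R\<^sup>2 + 3 * Y \<omega> + k * ((norm (G i \<omega>))\<^sup>2 + L\<^sup>2 * R\<^sup>2 + L\<^sup>2 * Y \<omega>)"
    show "integrable P ?K" using Y_int G_int[OF i] by auto
    show "AE \<omega> in P. (norm (w \<omega> i - wstar i))\<^sup>2 \<le> ?K \<omega>"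
      using stationary
    proof eventually_elim
      case (elim \<omega>)
      have x: "(norm (v \<omega> - ubar))\<^sup>2 \<le> Y \<omega>"
        using regularized_stationary.consensus_error_square_le[OF elim]
          q1_domain_contraction(1)[OF mu L dom]
        by (simp add: Y_def M_def T_def G_def a_def)
      have "(norm (w \<omega> i - wstar i))\<^sup>2 \<le> 3 * R\<^sup>2 + 3 * (norm (v \<omega> - ubar))\<^sup>2
          + k * ((norm (G i \<omega>))\<^sup>2 + L\<^sup>2 * R\<^sup>2 + L\<^sup>2 * (norm (v \<omega> - ubar))\<^sup>2)"
        using regularized_stationary.local_error_square_le_consensus[OF elim i] by (simp add: k_def G_def)
      also have "\<dots> \<le> ?K \<omega>"
        using x k by (intro add_mono mult_left_mono order_refl) auto
      finally show ?case .
    qed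
    have "expectation Y = 5 * (a\<^sup>2 * expectation M + a\<^sup>2 * (L\<^sup>2 * R\<^sup>2) + expectation T / \<mu>\<^sup>2 + L\<^sup>2 * R\<^sup>2 / \<mu>\<^sup>2)"
      unfolding Y_def[abs_def] using M_int T_int by (simp add: prob_space)
    also have "\<dots> \<le> 5 * (a\<^sup>2 * r + a\<^sup>2 * (L\<^sup>2 * R\<^sup>2) + \<rho>\<^sup>2 / real N / \<mu>\<^sup>2 + L\<^sup>2 * R\<^sup>2 / \<mu>\<^sup>2)"
      using M_le T_le by (intro add_mono mult_left_mono divide_right_mono order_refl) auto
    finally have Y_le: "expectation Y \<le> \<dots>" .
    have "expectation ?K = 3 * R\<^sup>2 + 3 * expectation Y
        + k * (expectation (\<lambda>\<omega>. (norm (G i \<omega>))\<^sup>2) + L\<^sup>2 * R\<^sup>2 + L\<^sup>2 * expectation Y)"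
      using Y_int G_int[OF i] by (simp add: prob_space)
    also have "\<dots> \<le> 3 * R\<^sup>2 + 3 * expectation Y + k * (r + L\<^sup>2 * R\<^sup>2 + L\<^sup>2 * expectation Y)"
      using G_le[OF i] k by (intro add_mono mult_left_mono order_refl) auto
    also have "\<dots> \<le> B1"
      unfolding B1_def k_def r_def
      by (intro consensus_rate_le[OF mu L dom] Y_le[unfolded a_def r_def])
    finally show "expectation ?K \<le> B1" .
  qed simp

  show ?thesis
    using le_B1 le_B2 mono_on_q1[OF mu L] tendsto_q1[OF mu L] by (simp add: min_def)
qed

end
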